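(* For every divisor $D$ on a finite connected graph $G=(V,E)$, $$r(D)-r(K-D)=\deg D+1-g,$$ where $g=|E|-|V|+1$. Equivalently, the rank defect is governed by the Euler characteristic of the master complex, and the only obstruction sits in $H^1\mathbf D\cong\mathrm{tors}\,\mathrm{Jac}(G)$.
   Context: Let $C_0=\mathbb{Z}^V$, $C_1=\mathbb{Z}^E$, fix an orientation of the edges, and let $\partial:C_1\to C_0$ be the boundary map and $L=\partial\partial^{\top}$ the combinatorial Laplacian. A divisor is an element of $\mathrm{Div}(G)=\mathbb{Z}^V$, and $\deg:\mathbb{Z}^V\to\mathbb{Z}$ is the sum of coordinates. $\mathrm{Prin}(G)=\operatorname{im}(L)$ is the group of principal divisors, $\mathrm{Jac}(G)=\mathrm{Div}(G)/\mathrm{Prin}(G)$ is called the Jacobian (critical/sandpile) group, and $\mathrm{tors}$ denotes the torsion subgroup. The canonical divisor $K$ is given by $K(v)=\deg(v)-2$, where $\deg(v)$ is the degree of the vertex $v$; $\deg K=2g-2$. The rank of a divisor $D$ is defined by $$r(D)=\max\{k\in\mathbb{Z}_{\ge -1} : \forall E'\subset V,\ |E'|=k,\ \exists\,\varphi\in\mathrm{Prin}(G)\ \text{such that}\ D-\varphi-\mathbf 1_{E'}\ge 0\},$$ where $\mathbf 1_{E'}$ is the indicator divisor of the vertex subset $E'$ and $\ge 0$ is meant coordinatewise (this is what the source calls the Baker–Norine notion of rank). $\mathbf D=\mathrm{RHom}_{\mathbb{Z}}(-,\mathbb{Z})$ is the derived dual on the bounded-below derived category of finitely generated abelian groups. The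 master two-term complex is $C_\bullet(G)=[C_1\xrightarrow{\partial}C_0]$, with $C_1$ in degree $1$ and $C_0$ in degree $0$. It is used through the associated complex $\mathrm{Cone}(\partial)=[C_1\xrightarrow{\binom{\partial}{0}}C_0\oplus\mathbb{Z}\xrightarrow{(\deg,-\mathrm{id})}\mathbb{Z}]$ and its divisor presentation $D_{\mathrm{div}}(G)=[\mathrm{Prin}(G)\hookrightarrow\mathrm{Div}(G)\xrightarrow{\deg}\mathbb{Z}]$ (left term placed in degree $-1$, middle term in degree $0$, right term in degree $0$ following the displayed arrows), which the source identifies with $\mathrm{Cone}(\partial)$ up to quasi-isomorphism. $H^1\mathbf D$ denotes $H^1\mathbf D(\mathrm{Cone}(\partial))$. The Euler characteristic is taken to be $\chi(\mathbf D(D_{\mathrm{div}}(G)))=\mathrm{rank}_{\mathbb{Z}}\mathrm{Hom}(\mathrm{Div}(G),\mathbb{Z})-\mathrm{rank}_{\mathbb{Z}}\mathrm{Hom}(\mathrm{Prin}(G),\mathbb{Z})=1$.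
   Formalization: Rank uses multisets E' of vertices (with subsets the maximum does not exist); G is loopless with multiple edges allowed (the formula fails with loops); H^1 D is taken of D_div(G), right term in degree 1, not of Cone(∂), whose dual has free cohomology and so is not tors Jac(G) in general. *)

theory Defs
  imports
    "Graph_Theory.Graph_Theory"
    "HOL-Algebra.Free_Abelian_Groups"
    "HOL-Library.Multiset"
begin

text \<open>
  A finite multigraph with a fixed orientation of its edges is a finite \<open>pre_digraph\<close>: the arcs are
  the edges, and \<open>tail\<close>, \<open>head\<close> record the orientation.  The group \<open>\<int>\<^sup>S\<close> is the
  library's \<open>free_Abelian_group S\<close>, whose elements are the finitely supported functions
  \<open>\<Rightarrow>\<^sub>0 int\<close> with support in \<open>S\<close>.
\<close>

section \<open>Divisors on an oriented graph\<close>

definition boundary :: "('v,'e) pre_digraph \<Rightarrow> ('e \<Rightarrow>\<^sub>0 int) \<Rightarrow> ('v \<Rightarrow>\<^sub>0 int)" where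
  "boundary G = frag_extend (\<lambda>e. frag_of (head G e) - frag_of (tail G e))"

text \<open>The transpose: the coefficient of \<open>e\<close> in the image of \<open>v\<close> is the coefficient of \<open>v\<close> in
  the boundary of \<open>e\<close>.\<close>

definition coboundary :: "('v,'e) pre_digraph \<Rightarrow> ('v \<Rightarrow>\<^sub>0 int) \<Rightarrow> ('e \<Rightarrow>\<^sub>0 int)" where
  "coboundary G = frag_extend (\<lambda>v. \<Sum>e\<in>arcs G.
     frag_cmul (Poly_Mapping.lookup (boundary G (frag_of e)) v) (frag_of e))"

definition laplacian :: "('v,'e) pre_digraph \<Rightarrow> ('v \<Rightarrow>\<^sub>0 int) \<Rightarrow> ('v \<Rightarrow>\<^sub>0 int)" where
  "laplacian G D = boundary G (coboundary G D)"

definition Div :: "('v,'e) pre_digraph \<Rightarrow> ('v \<Rightarrow>\<^sub>0 int) monoid" where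
  "Div G = free_Abelian_group (verts G)"

definition Prin :: "('v,'e) pre_digraph \<Rightarrow> ('v \<Rightarrow>\<^sub>0 int) monoid" where
  "Prin G = (Div G)\<lparr>carrier := laplacian G ` carrier (Div G)\<rparr>"

definition Jac :: "('v,'e) pre_digraph \<Rightarrow> ('v \<Rightarrow>\<^sub>0 int) set monoid" where
  "Jac G = Div G Mod carrier (Prin G)"

definition divisor_deg :: "('v,'e) pre_digraph \<Rightarrow> ('v \<Rightarrow>\<^sub>0 int) \<Rightarrow> int" where
  "divisor_deg G D = (\<Sum>v\<in>verts G. Poly_Mapping.lookup D v)"

definition vertex_degree :: "('v,'e) pre_digraph \<Rightarrow> 'v \<Rightarrow> nat" where
  "vertex_degree G v = in_degree G v + out_degree G v"

definition canonical_divisor :: "('v,'e) pre_digraph \<Rightarrow> ('v \<Rightarrow>\<^sub>0 int)" where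
  "canonical_divisor G = (\<Sum>v\<in>verts G. frag_cmul (int (vertex_degree G v) - 2) (frag_of v))"

definition genus :: "('v,'e) pre_digraph \<Rightarrow> int" where
  "genus G = int (card (arcs G)) - int (card (verts G)) + 1"

definition effective :: "('v,'e) pre_digraph \<Rightarrow> ('v \<Rightarrow>\<^sub>0 int) \<Rightarrow> bool" where
  "effective G D \<longleftrightarrow> (\<forall>v\<in>verts G. 0 \<le> Poly_Mapping.lookup D v)"

definition indicator_divisor :: "'v multiset \<Rightarrow> ('v \<Rightarrow>\<^sub>0 int)" where
  "indicator_divisor E = (\<Sum>v\<in>#E. frag_of v)"

text \<open>
  Baker--Norine rank.  The \<open>k\<close> vertices removed from \<open>D\<close> form a multiset: repetitions are allowed,
  so \<open>indicator_divisor E\<close> runs over all effective divisors of degree \<open>k\<close>.  With repetition-free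
  vertex sets the condition would be vacuous for every \<open>k > card (verts G)\<close> and the maximum would
  not exist.  For \<open>k = -1\<close> the condition is vacuous, as intended.
\<close>

definition divisor_rank :: "('v,'e) pre_digraph \<Rightarrow> ('v \<Rightarrow>\<^sub>0 int) \<Rightarrow> int" where
  "divisor_rank G D = Max {k. -1 \<le> k \<and>
     (\<forall>E. set_mset E \<subseteq> verts G \<and> int (size E) = k \<longrightarrow>
        (\<exists>\<phi>\<in>carrier (Prin G). effective G (D - \<phi> - indicator_divisor E)))}"

section \<open>Abelian groups: torsion, rank, duals\<close>

definition tors :: "'a monoid \<Rightarrow> 'a monoid" where
  "tors A = A\<lparr>carrier := {x \<in> carrier A. \<exists>n::nat. n > 0 \<and> x [^]\<^bsub>A\<^esub> n = \<one>\<^bsub>A\<^esub>}\<rparr>"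

definition int_independent :: "'a monoid \<Rightarrow> 'a set \<Rightarrow> bool" where
  "int_independent A S \<longleftrightarrow> (\<forall>c :: 'a \<Rightarrow> int.
     finprod A (\<lambda>s. s [^]\<^bsub>A\<^esub> c s) S = \<one>\<^bsub>A\<^esub> \<longrightarrow> (\<forall>s\<in>S. c s = 0))"

text \<open>Rank of an abelian group of finite rank (the supremum is taken in \<open>nat\<close>).\<close>

definition abelian_rank :: "'a monoid \<Rightarrow> nat" where
  "abelian_rank A = Sup {card S | S. finite S \<and> S \<subseteq> carrier A \<and> int_independent A S}"

text \<open>
  \<open>Hom(A,\<int>)\<close> under pointwise addition.  Elements of \<open>hom\<close> are unconstrained off the carrier, so
  the dual consists of the extensional ones.
\<close>

definition dual_group :: "'a monoid \<Rightarrow> ('a \<Rightarrow> int) monoid" where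
  "dual_group A =
     \<lparr>carrier = hom A integer_group \<inter> extensional (carrier A),
      monoid.mult = (\<lambda>f g. \<lambda>x\<in>carrier A. f x + g x),
      one = (\<lambda>x\<in>carrier A. 0)\<rparr>"

definition dual_map :: "'a monoid \<Rightarrow> ('a \<Rightarrow> 'b) \<Rightarrow> ('b \<Rightarrow> int) \<Rightarrow> ('a \<Rightarrow> int)" where
  "dual_map A h f = (\<lambda>x\<in>carrier A. f (h x))"

section \<open>Complexes in degrees -1, 0, 1\<close>

record ('a,'b,'c) complex3 =
  obj_neg :: "'a monoid"
  obj_zero :: "'b monoid"
  obj_pos :: "'c monoid"
  diff_neg :: "'a \<Rightarrow> 'b"
  diff_zero :: "'b \<Rightarrow> 'c"

definition H_neg :: "('a,'b,'c) complex3 \<Rightarrow> 'a monoid" where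
  "H_neg X = (obj_neg X)\<lparr>carrier := kernel (obj_neg X) (obj_zero X) (diff_neg X)\<rparr>"

definition H_zero :: "('a,'b,'c) complex3 \<Rightarrow> 'b set monoid" where
  "H_zero X = (obj_zero X)\<lparr>carrier := kernel (obj_zero X) (obj_pos X) (diff_zero X)\<rparr>
                Mod (diff_neg X ` carrier (obj_neg X))"

definition H_pos :: "('a,'b,'c) complex3 \<Rightarrow> 'c set monoid" where
  "H_pos X = obj_pos X Mod (diff_zero X ` carrier (obj_zero X))"

text \<open>
  On a bounded complex of finitely generated free abelian groups, \<open>RHom(-,\<int>)\<close> is the termwise
  dual, with \<open>Hom(X\<^sup>-\<^sup>i,\<int>)\<close> in degree \<open>i\<close>.  It is applied below only to such a complex
  (\<open>Prin G\<close> is a subgroup of \<open>Div G\<close>, hence free).  Signs of the differentials are immaterial for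
  cohomology and are omitted.
\<close>

definition derived_dual ::
    "('a,'b,'c) complex3 \<Rightarrow> ('c \<Rightarrow> int, 'b \<Rightarrow> int, 'a \<Rightarrow> int) complex3" where
  "derived_dual X =
     \<lparr>obj_neg = dual_group (obj_pos X),
      obj_zero = dual_group (obj_zero X),
      obj_pos = dual_group (obj_neg X),
      diff_neg = dual_map (obj_zero X) (diff_zero X),
      diff_zero = dual_map (obj_neg X) (diff_neg X)\<rparr>"

text \<open>The divisor presentation \<open>Prin(G) \<rightarrow> Div(G) \<rightarrow> \<int>\<close>, inclusion followed by degree.\<close>

definition D_div ::
    "('v,'e) pre_digraph \<Rightarrow> ('v \<Rightarrow>\<^sub>0 int, 'v \<Rightarrow>\<^sub>0 int, int) complex3" where
  "D_div G =
     \<lparr>obj_neg = Prin G,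
      obj_zero = Div G,
      obj_pos = integer_group,
      diff_neg = (\<lambda>D. D),
      diff_zero = divisor_deg G\<rparr>"

text \<open>
  The Euler characteristic of the dual of the divisor presentation is by convention
  \<open>rank Hom(Div(G),\<int>) - rank Hom(Prin(G),\<int>)\<close>; the term \<open>Hom(\<int>,\<int>)\<close> dual to the target of the
  degree map is not counted.
\<close>

definition master_euler_char :: "('v,'e) pre_digraph \<Rightarrow> int" where
  "master_euler_char G =
     int (abelian_rank (obj_zero (derived_dual (D_div G))))
     - int (abelian_rank (obj_pos (derived_dual (D_div G))))"

end

theory Submission
  imports Defs
begin

text \<open>
  The Riemann--Roch formula follows Baker and Norine.  Every enumeration \<open>p\<close> of the vertices yields a
  divisor \<open>\<nu>\<close> (number of edges to earlier vertices, minus one) of degree \<open>g - 1\<close>, and the reversed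
  enumeration yields \<open>K - \<nu>\<close>.  No such \<open>\<nu>\<close> is equivalent to an effective divisor
  (\<open>order_divisor_unwinnable\<close>), and conversely every divisor that is not equivalent to an effective
  one lies, up to equivalence, below some \<open>\<nu>\<close> (\<open>winnable_or_below_order_divisor\<close>).  The converse
  passes to a \<open>q\<close>-reduced representative and enumerates the vertices by Dhar's burning algorithm.

  If now \<open>E\<close> is effective of degree \<open>r(D) + 1\<close> and \<open>D - E\<close> is not equivalent to an effective divisor,
  then \<open>D - E\<close> is equivalent to \<open>\<nu> - E'\<close> with \<open>E'\<close> effective, so \<open>(K - D) - E'\<close> is equivalent to
  \<open>(K - \<nu>) - E\<close>, again not equivalent to an effective divisor (\<open>unwinnable_dual\<close>).  Therefore
  \<open>r(K - D) < deg E'\<close>, which is the inequality \<open>deg D + 1 - g \<le> r(D) - r(K - D)\<close>.  Exchanging \<open>D\<close>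
  and \<open>K - D\<close> reverses it.

  The homological part rests on two properties of the Laplacian \<open>L\<close>: it is self-adjoint, and its
  kernel consists of the constants.  A functional on \<open>Div G\<close> is an integer function on the vertices.
  A functional \<open>f\<close> on \<open>Prin G\<close> is encoded by the divisor \<open>v \<mapsto> f (L v)\<close>, and exactly the divisors of
  degree zero arise.  This gives the ranks \<open>|V|\<close> and \<open>|V| - 1\<close>, hence Euler characteristic \<open>1\<close>.  In
  these terms restriction from \<open>Div G\<close> to \<open>Prin G\<close> is the Laplacian.  Its kernel is spanned by the
  degree map, so the cohomology in degrees \<open>-1\<close> and \<open>0\<close> vanishes, and its cokernel is the group of
  divisors of degree zero modulo principal divisors.  That group is the torsion of the Jacobian,
  because a multiple of every divisor of degree zero is principal (\<open>degree_zero_imp_torsion\<close>).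
\<close>

section \<open>Integer relations\<close>

text \<open>
  Gaussian elimination without division: if \<open>t\<close> has a nonzero coordinate \<open>i\<close>, replacing each other row \<open>s\<close> by
  \<open>M t i \<cdot> s - M s i \<cdot> t\<close> clears that coordinate, and a relation among the new rows is one among
  the old.
\<close>

lemma ex_nontrivial_integer_relation:
  fixes M :: "'s \<Rightarrow> 'i \<Rightarrow> int"
  assumes "finite F" "finite S" "card F < card S"
  shows "\<exists>c. (\<exists>s\<in>S. c s \<noteq> 0) \<and> (\<forall>i\<in>F. (\<Sum>s\<in>S. c s * M s i) = 0)"
  using assms
proof (induction F arbitrary: S M rule: finite_induct)
  case empty
  then obtain s where "s \<in> S" by (metis all_not_in_conv card.empty less_irrefl)
  then show ?case by (intro exI[of _ "\<lambda>_. 1"]) auto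
next
  case (insert i F)
  show ?case
  proof (cases "\<forall>s\<in>S. M s i = 0")
    case True
    have "card F < card S" using insert by simp
    from insert.IH[OF insert.prems(1) this, of M] obtain c where
      "\<exists>s\<in>S. c s \<noteq> 0" "\<forall>j\<in>F. (\<Sum>s\<in>S. c s * M s j) = 0" by blast
    with True show ?thesis by (intro exI[of _ c]) auto
  next
    case False
    then obtain t where t: "t \<in> S" "M t i \<noteq> 0" by blast
    let ?S = "S - {t}"
    have "finite ?S" "card F < card ?S" using insert t by auto
    from insert.IH[OF this, of "\<lambda>s j. M t i * M s j - M s i * M t j"] obtain c where
      c: "\<exists>s\<in>?S. c s \<noteq> 0" "\<forall>j\<in>F. (\<Sum>s\<in>?S. c s * (M t i * M s j - M s i * M t j)) = 0"
      by blast
    define d where "d s = (if s = t then - (\<Sum>s\<in>?S. c s * M s i) else M t i * c s)" for s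
    have sum_d: "(\<Sum>s\<in>S. d s * M s j) = (\<Sum>s\<in>?S. c s * (M t i * M s j - M s i * M t j))" for j
    proof -
      have "(\<Sum>s\<in>S. d s * M s j) = d t * M t j + (\<Sum>s\<in>?S. d s * M s j)"
        using t insert.prems(1) by (simp add: sum.remove)
      also have "(\<Sum>s\<in>?S. d s * M s j) = (\<Sum>s\<in>?S. M t i * c s * M s j)"
        by (rule sum.cong) (auto simp: d_def)
      finally show ?thesis
        by (simp add: d_def algebra_simps sum_subtractf sum_distrib_left)
    qed
    have "\<exists>s\<in>S. d s \<noteq> 0" using c(1) t by (auto simp: d_def)
    moreover have "(\<Sum>s\<in>S. d s * M s j) = 0" if "j \<in> insert i F" for j
      using that c(2) by (auto simp: sum_d)
    ultimately show ?thesis by blast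
  qed
qed

section \<open>Chip firing on a connected weighted vertex set\<close>

text \<open>
  For chip firing only the number \<open>w u v\<close> of edges between two vertices matters, so orientations
  and edge names are dropped, and divisors become functions of which only the values on \<open>V\<close>
  count.  Connectedness is stated as the existence of an edge across every cut; this is the form in
  which all the arguments below use it.
\<close>

locale connected_edge_weights =
  fixes V :: "'v set" and w :: "'v \<Rightarrow> 'v \<Rightarrow> int"
  assumes finite_V [simp]: "finite V"
    and V_nonempty: "V \<noteq> {}"
    and w_nonneg: "0 \<le> w u v"
    and w_sym: "w u v = w v u"
    and w_self: "w v v = 0"
    and edge_cut: "A \<subseteq> V \<Longrightarrow> A \<noteq> {} \<Longrightarrow> A \<noteq> V \<Longrightarrow> \<exists>u\<in>A. \<exists>v\<in>V - A. 0 < w u v"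
begin

definition lap :: "('v \<Rightarrow> int) \<Rightarrow> 'v \<Rightarrow> int" where
  "lap f v = (\<Sum>u\<in>V. w u v * (f v - f u))"

text \<open>
  The canonical divisor \<open>K\<close>.
\<close>

definition canon :: "'v \<Rightarrow> int" where
  "canon v = (\<Sum>u\<in>V. w u v) - 2"

text \<open>
  Linear equivalence to an effective divisor.
\<close>

definition winnable :: "('v \<Rightarrow> int) \<Rightarrow> bool" where
  "winnable D \<longleftrightarrow> (\<exists>f. \<forall>v\<in>V. 0 \<le> D v - lap f v)"

text \<open>
  The function \<open>p\<close> lists the vertices, and orienting every edge from its earlier to its later end
  gives, for injective \<open>p\<close>, an acyclic orientation; \<open>order_divisor p\<close> is its indegree minus one.
  Up to equivalence these are the maximal unwinnable divisors.  Letting \<open>p\<close> take integer values makes \<open>- p\<close> the reversed list.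
\<close>

definition order_divisor :: "('v \<Rightarrow> int) \<Rightarrow> 'v \<Rightarrow> int" where
  "order_divisor p v = (\<Sum>u\<in>{u \<in> V. p u < p v}. w u v) - 1"

lemma lap_add: "lap (\<lambda>v. f v + g v) v = lap f v + lap g v"
  unfolding lap_def sum.distrib[symmetric] by (rule sum.cong) (auto simp: algebra_simps)

lemma lap_diff: "lap (\<lambda>v. f v - g v) v = lap f v - lap g v"
  unfolding lap_def sum_subtractf[symmetric] by (rule sum.cong) (auto simp: algebra_simps)

lemma lap_scale: "lap (\<lambda>v. c * f v) v = c * lap f v"
  unfolding lap_def sum_distrib_left by (rule sum.cong) (auto simp: algebra_simps)

lemma lap_const [simp]: "lap (\<lambda>_. c) v = 0"
  by (simp add: lap_def)

lemma lap_uminus: "lap (\<lambda>v. - f v) v = - lap f v"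
  using lap_scale[of "-1" f v] by simp

lemma lap_cong: "(\<And>u. u \<in> V \<Longrightarrow> f u = g u) \<Longrightarrow> v \<in> V \<Longrightarrow> lap f v = lap g v"
  unfolding lap_def by (rule sum.cong) auto

lemma lap_self_adjoint: "(\<Sum>v\<in>V. g v * lap f v) = (\<Sum>v\<in>V. lap g v * f v)"
proof -
  have expand: "(\<Sum>v\<in>V. x v * lap y v)
      = (\<Sum>v\<in>V. \<Sum>u\<in>V. w u v * (x v * y v)) - (\<Sum>v\<in>V. \<Sum>u\<in>V. w u v * (x v * y u))" for x y
    unfolding lap_def sum_distrib_left sum_subtractf[symmetric]
    by (intro sum.cong refl) (simp add: algebra_simps)
  have "(\<Sum>v\<in>V. \<Sum>u\<in>V. w u v * (g v * f u)) = (\<Sum>u\<in>V. \<Sum>v\<in>V. w u v * (g v * f u))"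
    by (rule sum.swap)
  also have "\<dots> = (\<Sum>v\<in>V. \<Sum>u\<in>V. w u v * (f v * g u))"
    by (intro sum.cong refl) (subst w_sym, simp add: mult.commute)
  finally have "(\<Sum>v\<in>V. g v * lap f v) = (\<Sum>v\<in>V. f v * lap g v)"
    unfolding expand by (simp add: mult.commute)
  then show ?thesis by (simp add: mult.commute)
qed

lemma sum_lap [simp]: "(\<Sum>v\<in>V. lap f v) = 0"
  using lap_self_adjoint[of "\<lambda>_. 1" f] by simp

text \<open>
  Minimum principle: if the set where \<open>f\<close> attains its minimum were not all of \<open>V\<close>, an edge would
  leave it, and at the inner end of that edge \<open>lap f\<close> would be negative.
\<close>

lemma harmonic_imp_constant:
  assumes "\<And>v. v \<in> V \<Longrightarrow> lap f v = 0"
  obtains c where "\<And>v. v \<in> V \<Longrightarrow> f v = c"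
proof -
  define c where "c = Min (f ` V)"
  define A where "A = {v \<in> V. f v = c}"
  have le: "c \<le> f v" if "v \<in> V" for v using that by (simp add: c_def)
  have "c \<in> f ` V" unfolding c_def by (rule Min_in) (use V_nonempty in auto)
  then have "A \<noteq> {}" by (auto simp: A_def)
  have "A = V"
  proof (rule ccontr)
    assume "A \<noteq> V"
    with edge_cut[of A] \<open>A \<noteq> {}\<close> obtain u v where uv: "u \<in> A" "v \<in> V - A" "0 < w u v"
      by (auto simp: A_def)
    have "lap f u < (\<Sum>x\<in>V. 0)" unfolding lap_def
    proof (rule sum_strict_mono_ex1)
      show "\<forall>x\<in>V. w x u * (f u - f x) \<le> 0"
        using uv le w_nonneg by (auto simp: A_def mult_nonneg_nonpos)
      have "w v u * (f u - f v) < 0"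
        using uv le[of v] by (auto simp: A_def w_sym[of v u] intro!: mult_pos_neg)
      then show "\<exists>x\<in>V. w x u * (f u - f x) < 0" using uv by blast
    qed simp
    with assms[of u] uv show False by (simp add: A_def)
  qed
  then show ?thesis by (intro that[of c]) (auto simp: A_def)
qed

text \<open>
  Induction along a sweep of the graph that starts at \<open>q\<close> and adds one vertex at a time, the
  next vertex being chosen according to the set already reached.
\<close>

lemma grow_from_vertex:
  assumes "q \<in> V" "P {q}"
    and step: "\<And>A. A \<subseteq> V \<Longrightarrow> A \<noteq> V \<Longrightarrow> q \<in> A \<Longrightarrow> P A \<Longrightarrow> \<exists>v\<in>V - A. P (insert v A)"
  shows "P V"
proof -
  have "P V" if "A \<subseteq> V" "q \<in> A" "P A" for A
    using that
  proof (induction "card (V - A)" arbitrary: A rule: less_induct)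
    case less
    show ?case
    proof (cases "A = V")
      case False
      then obtain v where v: "v \<in> V - A" "P (insert v A)" using step less.prems by metis
      have "card (V - insert v A) < card (V - A)"
        by (rule psubset_card_mono) (use v in auto)
      then show ?thesis by (rule less.hyps) (use v less.prems in auto)
    qed (use less.prems in simp)
  qed
  then show ?thesis using assms(1,2) by blast
qed

text \<open>
  Built by adding vertices one at a time.  If \<open>h\<close> is positive on \<open>A\<close> and zero elsewhere, then at a
  neighbour \<open>v\<close> of \<open>A\<close> the value of \<open>lap h\<close> is negative.  Multiplying \<open>h\<close> by a large \<open>M\<close> leaves
  enough room to raise the value at \<open>v\<close> to \<open>1\<close>, which costs at \<open>v\<close> no more than its degree and
  only lowers the Laplacian elsewhere.
\<close>

lemma ex_strictly_subharmonic_off: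
  assumes "q \<in> V"
  obtains h where "\<And>v. v \<in> V - {q} \<Longrightarrow> lap h v \<le> -1"
proof -
  define P where "P A \<longleftrightarrow> (\<exists>h. (\<forall>v\<in>V. 0 \<le> h v) \<and> (\<forall>v\<in>A. 0 < h v) \<and> (\<forall>v\<in>V - A. h v = 0) \<and>
      (\<forall>v\<in>A - {q}. lap h v \<le> -1))" for A
  have "P V"
  proof (rule grow_from_vertex[OF assms])
    show "P {q}" unfolding P_def by (rule exI[of _ "\<lambda>v. if v = q then 1 else 0"]) auto
    fix A assume A: "A \<subseteq> V" "A \<noteq> V" "q \<in> A" "P A"
    then obtain h where h: "\<forall>v\<in>V. 0 \<le> h v" "\<forall>v\<in>A. 0 < h v" "\<forall>v\<in>V - A. h v = 0"
      "\<forall>v\<in>A - {q}. lap h v \<le> -1" unfolding P_def by blast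
    from edge_cut[of A] A obtain u v where uv: "u \<in> A" "v \<in> V - A" "0 < w u v" by blast
    define e where "e x = (if x = v then 1 else 0 :: int)" for x
    define M where "M = (\<Sum>x\<in>V. w x v) + 1"
    have M: "1 \<le> M" by (simp add: M_def sum_nonneg w_nonneg)
    define k where "k x = M * h x + e x" for x
    have lap_k: "lap k x = M * lap h x + lap e x" for x
      unfolding k_def by (simp add: lap_add lap_scale)
    have hv: "h v = 0" using h uv by simp
    have "lap h v \<le> -1"
    proof -
      have "1 \<le> w u v * h u" using uv h(2) by (smt (verit) mult_pos_pos)
      also have "\<dots> \<le> (\<Sum>x\<in>V. w x v * h x)"
        by (rule member_le_sum) (use uv A h w_nonneg in \<open>auto intro: mult_nonneg_nonneg\<close>)
      finally show ?thesis by (simp add: lap_def hv sum_negf)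
    qed
    then have "M * lap h v \<le> M * (-1)" using M by (intro mult_left_mono) auto
    moreover have "lap e v \<le> M - 1"
      unfolding lap_def M_def using w_nonneg
      by (simp, intro sum_mono) (auto simp: e_def)
    ultimately have "lap k v \<le> -1" unfolding lap_k by simp
    moreover have "lap k x \<le> -1" if "x \<in> A - {q}" for x
    proof -
      have "lap h x \<le> -1" using h that by blast
      then have "M * lap h x \<le> M * (-1)" using M by (intro mult_left_mono) auto
      moreover have "lap e x \<le> 0"
        unfolding lap_def using that uv w_nonneg by (intro sum_nonpos) (auto simp: e_def)
      ultimately show ?thesis unfolding lap_k using M by simp
    qed
    moreover have "0 \<le> k x" if "x \<in> V" for x using that h M by (auto simp: k_def e_def)
    moreover have "0 < k x" if "x \<in> insert v A" for x
      using that h M hv by (auto simp: k_def e_def)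
    ultimately have "P (insert v A)" unfolding P_def using h uv
      by (intro exI[of _ k]) (auto simp: k_def e_def)
    then show "\<exists>v\<in>V - A. P (insert v A)" using uv by blast
  qed
  then show ?thesis using that unfolding P_def by auto
qed

lemma lap_nonneg_at_max:
  assumes "v \<in> V" "\<And>u. u \<in> V \<Longrightarrow> f u \<le> f v"
  shows "0 \<le> lap f v"
  unfolding lap_def using assms w_nonneg by (auto intro!: sum_nonneg)

text \<open>
  Every divisor is equivalent to one that is reduced at \<open>q\<close>: nonnegative off \<open>q\<close>, while firing any
  nonempty set of vertices other than \<open>q\<close> would put some vertex of the set into debt.  With \<open>h\<close>
  strictly subharmonic off \<open>q\<close>, subtracting a large multiple of \<open>lap h\<close> achieves the first
  property.  Among the representatives with the first property take one that minimises
  \<open>\<Phi> = \<Sum> b v \<cdot> (D v - lap f v)\<close> for \<open>b = h q - h\<close>.  Then \<open>b\<close> is nonnegative, it vanishes at \<open>q\<close>, so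
  \<open>\<Phi>\<close> is nonnegative, and by self-adjointness a legal firing of a set \<open>A\<close> lowers \<open>\<Phi>\<close> by the sum of
  \<open>lap b\<close> over \<open>A\<close>, which is positive.
\<close>

lemma ex_reduced:
  assumes q: "q \<in> V"
  obtains f where "\<And>v. v \<in> V - {q} \<Longrightarrow> 0 \<le> D v - lap f v"
    and "\<And>A. A \<subseteq> V - {q} \<Longrightarrow> A \<noteq> {} \<Longrightarrow> \<exists>v\<in>A. D v - lap f v < (\<Sum>u\<in>V - A. w u v)"
proof -
  obtain h where h: "\<And>v. v \<in> V - {q} \<Longrightarrow> lap h v \<le> -1"
    using ex_strictly_subharmonic_off[OF q] by blast
  have hq: "h v \<le> h q" if "v \<in> V" for v
  proof -
    have "Max (h ` V) \<in> h ` V" using V_nonempty by (intro Max_in) auto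
    then obtain m where m: "m \<in> V" "h m = Max (h ` V)" by auto
    then have max: "h u \<le> h m" if "u \<in> V" for u using that by simp
    have "0 \<le> lap h m" using m(1) max by (rule lap_nonneg_at_max)
    then have "m = q" using h[of m] m(1) by (cases "m = q") auto
    then show ?thesis using max that by simp
  qed
  define b where "b v = h q - h v" for v
  have lap_b: "lap b v = - lap h v" for v unfolding b_def lap_diff by simp
  define good where "good f \<longleftrightarrow> (\<forall>v\<in>V - {q}. 0 \<le> D v - lap f v)" for f
  define \<Phi> where "\<Phi> f = (\<Sum>v\<in>V. b v * (D v - lap f v))" for f
  have \<Phi>_nonneg: "0 \<le> \<Phi> f" if "good f" for f
    unfolding \<Phi>_def
  proof (rule sum_nonneg)
    fix v assume "v \<in> V"
    then show "0 \<le> b v * (D v - lap f v)"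
      using that hq by (cases "v = q") (auto simp: good_def b_def)
  qed
  define N where "N = (\<Sum>v\<in>V. \<bar>D v\<bar>)"
  have "good (\<lambda>v. N * h v)" unfolding good_def
  proof
    fix v assume v: "v \<in> V - {q}"
    have "\<bar>D v\<bar> \<le> N" unfolding N_def by (rule member_le_sum) (use v in auto)
    moreover have "N * lap h v \<le> N * (-1)"
      using h[OF v] by (intro mult_left_mono) (auto simp: N_def sum_nonneg)
    ultimately show "0 \<le> D v - lap (\<lambda>v. N * h v) v" by (simp add: lap_scale)
  qed
  from ex_has_least_nat[of good, OF this, of "\<lambda>f. nat (\<Phi> f)"]
  obtain f where f: "good f" "\<And>g. good g \<Longrightarrow> nat (\<Phi> f) \<le> nat (\<Phi> g)" by blast
  show ?thesis
  proof (rule that[of f])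
    show "0 \<le> D v - lap f v" if "v \<in> V - {q}" for v using f that by (simp add: good_def)
    fix A assume A: "A \<subseteq> V - {q}" "A \<noteq> {}"
    show "\<exists>v\<in>A. D v - lap f v < (\<Sum>u\<in>V - A. w u v)"
    proof (rule ccontr)
      assume "\<not> ?thesis"
      then have enough: "(\<Sum>u\<in>V - A. w u v) \<le> D v - lap f v" if "v \<in> A" for v
        using that by (auto simp: not_less)
      define e where "e v = (if v \<in> A then 1 else 0 :: int)" for v
      define g where "g v = f v + e v" for v
      have lap_g: "lap g v = lap f v + lap e v" for v unfolding g_def by (rule lap_add)
      have lap_e: "lap e v = (\<Sum>u\<in>V - A. w u v)" if "v \<in> A" for v
        unfolding lap_def e_def using that A
        by (intro sum.mono_neutral_cong_right) auto
      have lap_e': "lap e v \<le> 0" if "v \<notin> A" for v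
        unfolding lap_def e_def using that w_nonneg
        by (intro sum_nonpos) auto
      have "good g" unfolding good_def
      proof
        fix v assume v: "v \<in> V - {q}"
        then have "0 \<le> D v - lap f v" using f by (simp add: good_def)
        then show "0 \<le> D v - lap g v"
          using enough lap_e lap_e' by (cases "v \<in> A") (force simp: lap_g)+
      qed
      have "(\<Sum>v\<in>V. b v * lap e v) = (\<Sum>v\<in>A. lap b v)"
        unfolding lap_self_adjoint e_def using A by (intro sum.mono_neutral_cong_right) auto
      moreover have "0 < (\<Sum>v\<in>A. lap b v)"
      proof (rule sum_pos)
        show "finite A" using finite_subset[of A V] A(1) finite_V by blast
        show "0 < lap b v" if "v \<in> A" for v
        proof -
          have "lap h v \<le> -1" using A(1) that by (intro h) auto
          then show ?thesis by (simp add: lap_b)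
        qed
      qed (rule A(2))
      moreover have "\<Phi> g = \<Phi> f - (\<Sum>v\<in>V. b v * lap e v)"
        unfolding \<Phi>_def lap_g sum_subtractf[symmetric] by (simp add: algebra_simps)
      ultimately have "\<Phi> g < \<Phi> f" by simp
      then show False using f(2)[OF \<open>good g\<close>] \<Phi>_nonneg[OF \<open>good g\<close>] by simp
    qed
  qed
qed

text \<open>
  Dhar's burning algorithm.  A fire starts at \<open>q\<close>, and a vertex burns once it has more burning edges
  than chips.  The hypothesis says that the fire never stops before it reaches every vertex, and \<open>p\<close>
  records the order in which the vertices burn.
\<close>

lemma ex_burning_order:
  assumes q: "q \<in> V"
    and burn: "\<And>A. A \<subseteq> V - {q} \<Longrightarrow> A \<noteq> {} \<Longrightarrow> \<exists>v\<in>A. D v < (\<Sum>u\<in>V - A. w u v)"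
  obtains p where "inj_on p V" "order_divisor p q = -1"
    "\<And>v. v \<in> V - {q} \<Longrightarrow> D v \<le> order_divisor p v"
proof -
  define P where "P A \<longleftrightarrow> (\<exists>p :: 'v \<Rightarrow> int. inj_on p A \<and> (\<forall>v\<in>A. p q \<le> p v) \<and>
    (\<forall>v\<in>A - {q}. D v \<le> (\<Sum>u\<in>{u \<in> A. p u < p v}. w u v) - 1))" for A
  have "P V"
  proof (rule grow_from_vertex[OF q])
    show "P {q}" unfolding P_def by auto
    fix A assume A: "A \<subseteq> V" "A \<noteq> V" "q \<in> A" "P A"
    then obtain p :: "'v \<Rightarrow> int" where p: "inj_on p A" "\<forall>v\<in>A. p q \<le> p v"
      "\<forall>v\<in>A - {q}. D v \<le> (\<Sum>u\<in>{u \<in> A. p u < p v}. w u v) - 1" unfolding P_def by blast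
    have "V - A \<noteq> {}" "V - A \<subseteq> V - {q}" "V - (V - A) = A" using A by auto
    with burn[of "V - A"] obtain v where v: "v \<in> V - A" "D v < (\<Sum>u\<in>A. w u v)" by auto
    have finA: "finite A" by (rule finite_subset[OF A(1) finite_V])
    define t where "t = Max (p ` A) + 1"
    have t: "p u < t" if "u \<in> A" for u
    proof -
      have "p u \<le> Max (p ` A)" using that finA by simp
      then show ?thesis by (simp add: t_def)
    qed
    define p' where "p' = p(v := t)"
    have p'A: "p' u = p u" if "u \<in> A" for u using that v by (auto simp: p'_def)
    have p'v: "p' v = t" by (simp add: p'_def)
    have "inj_on p' (insert v A)"
    proof (rule inj_onI)
      fix x y assume xy: "x \<in> insert v A" "y \<in> insert v A" "p' x = p' y"
      show "x = y"
        using xy t[of x] t[of y] p'A[of x] p'A[of y] p'v inj_onD[OF p(1), of x y]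
        by (cases "x = v"; cases "y = v") auto
    qed
    moreover have "\<forall>x\<in>insert v A. p' q \<le> p' x"
      using p(2) t[OF A(3)] p'A p'v A(3) by auto
    moreover have "D x \<le> (\<Sum>u\<in>{u \<in> insert v A. p' u < p' x}. w u x) - 1"
      if x: "x \<in> insert v A - {q}" for x
    proof (cases "x = v")
      case True
      then have "{u \<in> insert v A. p' u < p' x} = A" using t p'A p'v v by auto
      then show ?thesis using v True by simp
    next
      case False
      then have "{u \<in> insert v A. p' u < p' x} = {u \<in> A. p u < p x}"
        using t[of x] p'A p'v v x by auto
      then show ?thesis using p(3) x False by auto
    qed
    ultimately have "P (insert v A)" unfolding P_def by blast
    then show "\<exists>v\<in>V - A. P (insert v A)" using v by blast
  qed
  then obtain p :: "'v \<Rightarrow> int" where p: "inj_on p V" "\<forall>v\<in>V. p q \<le> p v"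
    "\<forall>v\<in>V - {q}. D v \<le> order_divisor p v" unfolding P_def order_divisor_def by blast
  have "{u \<in> V. p u < p q} = {}" using p(2) by fastforce
  then have "order_divisor p q = -1" by (simp add: order_divisor_def del: Collect_empty_eq)
  then show ?thesis using p by (intro that[of p]) auto
qed

text \<open>
  After firing \<open>f\<close>, look at the vertex that comes first under \<open>p\<close> among those where \<open>f\<close> is
  maximal.  Every earlier vertex has a strictly smaller value of \<open>f\<close>, so at least one chip leaves
  along every edge to an earlier vertex; the order divisor has one chip too few for that.
\<close>

lemma order_divisor_unwinnable: "\<not> winnable (order_divisor p)"
proof
  assume "winnable (order_divisor p)"
  then obtain f where f: "\<forall>v\<in>V. 0 \<le> order_divisor p v - lap f v" unfolding winnable_def by blast
  define A where "A = {v \<in> V. f v = Max (f ` V)}"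
  have "Max (f ` V) \<in> f ` V" using V_nonempty by (intro Max_in) auto
  then have "finite A" "A \<noteq> {}" by (auto simp: A_def)
  then obtain v where v: "v \<in> A" "\<And>u. u \<in> A \<Longrightarrow> p v \<le> p u"
    by (metis arg_min_if_finite(1) arg_min_least)
  have max: "f u \<le> f v" if "u \<in> V" for u using v that by (simp add: A_def)
  have "order_divisor p v + 1 = (\<Sum>u\<in>{u \<in> V. p u < p v}. w u v)" by (simp add: order_divisor_def)
  also have "\<dots> \<le> (\<Sum>u\<in>{u \<in> V. p u < p v}. w u v * (f v - f u))"
  proof (rule sum_mono)
    fix u assume u: "u \<in> {u \<in> V. p u < p v}"
    then have "f u \<noteq> f v" using v by (force simp: A_def)
    then have "1 \<le> f v - f u" using max[of u] u by auto
    then show "w u v \<le> w u v * (f v - f u)"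
      using mult_left_mono[OF _ w_nonneg[of u v]] by fastforce
  qed
  also have "\<dots> \<le> lap f v"
    unfolding lap_def using max w_nonneg by (intro sum_mono2) auto
  finally show False using f v by (auto simp: A_def)
qed

text \<open>
  The converse: a reduced divisor lies off \<open>q\<close> below the order divisor of its burning order.  At \<open>q\<close>
  the order divisor is \<open>-1\<close>, and an unwinnable reduced divisor must be negative there.
\<close>

lemma winnable_or_below_order_divisor:
  assumes "\<not> winnable D"
  obtains p f where "inj_on p V" "\<And>v. v \<in> V \<Longrightarrow> D v - lap f v \<le> order_divisor p v"
proof -
  obtain q where q: "q \<in> V" using V_nonempty by blast
  obtain f where f: "\<And>v. v \<in> V - {q} \<Longrightarrow> 0 \<le> D v - lap f v"
    "\<And>A. A \<subseteq> V - {q} \<Longrightarrow> A \<noteq> {} \<Longrightarrow> \<exists>v\<in>A. D v - lap f v < (\<Sum>u\<in>V - A. w u v)"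
    using ex_reduced[OF q, of D] by blast
  obtain p where p: "inj_on p V" "order_divisor p q = -1"
    "\<And>v. v \<in> V - {q} \<Longrightarrow> D v - lap f v \<le> order_divisor p v"
    using ex_burning_order[OF q, of "\<lambda>v. D v - lap f v"] f(2) by blast
  have "D q - lap f q < 0"
    using assms f(1) unfolding winnable_def by (metis DiffI not_less singletonD)
  then show ?thesis using p that[of p f] by (metis DiffI add1_zle_eq add.left_inverse
    add_le_cancel_right empty_iff insert_iff order_trans zle_add1_eq_le)
qed

text \<open>
  Each edge at \<open>v\<close> goes either to an earlier or to a later vertex.
\<close>

lemma order_divisor_reverse:
  assumes "inj_on p V" "v \<in> V"
  shows "order_divisor p v + order_divisor (\<lambda>u. - p u) v = canon v"
proof -
  have "(\<Sum>u\<in>V. w u v) = (\<Sum>u\<in>V - {v}. w u v)"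
    using assms(2) by (simp add: sum.remove w_self)
  also have "V - {v} = {u \<in> V. p u < p v} \<union> {u \<in> V. - p u < - p v}"
    using assms by (auto simp: inj_on_def) (metis linorder_neqE)
  also have "(\<Sum>u\<in>\<dots>. w u v) = (\<Sum>u\<in>{u \<in> V. p u < p v}. w u v) + (\<Sum>u\<in>{u \<in> V. - p u < - p v}. w u v)"
    by (rule sum.union_disjoint) auto
  finally show ?thesis by (simp add: order_divisor_def canon_def)
qed

text \<open>
  The degree is \<open>g - 1\<close>, expressed as half the degree of \<open>K\<close>: reversing the order exchanges the two
  ends of each edge and so preserves the degree.
\<close>

lemma sum_order_divisor:
  assumes "inj_on p V"
  shows "2 * (\<Sum>v\<in>V. order_divisor p v) = (\<Sum>v\<in>V. canon v)"
proof -
  have "(\<Sum>v\<in>V. \<Sum>u\<in>{u \<in> V. p u < p v}. w u v) = (\<Sum>v\<in>V. \<Sum>u\<in>{u \<in> V. p v < p u}. w v u)"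
    by (rule sum.swap_restrict) auto
  also have "\<dots> = (\<Sum>v\<in>V. \<Sum>u\<in>{u \<in> V. p v < p u}. w u v)" by (simp add: w_sym)
  finally have "(\<Sum>v\<in>V. order_divisor p v) = (\<Sum>v\<in>V. order_divisor (\<lambda>u. - p u) v)"
    by (simp add: order_divisor_def sum_subtractf)
  moreover have "(\<Sum>v\<in>V. order_divisor p v) + (\<Sum>v\<in>V. order_divisor (\<lambda>u. - p u) v) = (\<Sum>v\<in>V. canon v)"
    unfolding sum.distrib[symmetric] using order_divisor_reverse[OF assms] by simp
  ultimately show ?thesis by simp
qed

text \<open>
  The core of Riemann--Roch.  If \<open>D - E\<close> is unwinnable, it is up to equivalence \<open>\<nu> - E'\<close> with \<open>\<nu>\<close> an
  order divisor and \<open>E'\<close> effective.  Hence \<open>K - D - E'\<close> is equivalent to \<open>(K - \<nu>) - E\<close>, which lies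
  below the order divisor \<open>K - \<nu>\<close> of the reversed order and so is unwinnable.
\<close>

lemma unwinnable_dual:
  assumes "\<not> winnable (\<lambda>v. D v - E v)" "\<And>v. v \<in> V \<Longrightarrow> 0 \<le> E v"
  obtains E' where "\<And>v. v \<in> V \<Longrightarrow> 0 \<le> E' v" "\<not> winnable (\<lambda>v. canon v - D v - E' v)"
    "2 * (\<Sum>v\<in>V. E' v) = 2 * (\<Sum>v\<in>V. E v) - 2 * (\<Sum>v\<in>V. D v) + (\<Sum>v\<in>V. canon v)"
proof -
  obtain p f where p: "inj_on p V" and le: "\<And>v. v \<in> V \<Longrightarrow> D v - E v - lap f v \<le> order_divisor p v"
    using winnable_or_below_order_divisor[OF assms(1)] by blast
  define E' where "E' v = order_divisor p v - (D v - E v - lap f v)" for v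
  show ?thesis
  proof (rule that[of E'])
    show "0 \<le> E' v" if "v \<in> V" for v using le[OF that] by (simp add: E'_def)
    show "2 * (\<Sum>v\<in>V. E' v) = 2 * (\<Sum>v\<in>V. E v) - 2 * (\<Sum>v\<in>V. D v) + (\<Sum>v\<in>V. canon v)"
      using sum_order_divisor[OF p] by (simp add: E'_def sum_subtractf)
    show "\<not> winnable (\<lambda>v. canon v - D v - E' v)"
    proof
      assume "winnable (\<lambda>v. canon v - D v - E' v)"
      then obtain g where g: "\<forall>v\<in>V. 0 \<le> canon v - D v - E' v - lap g v"
        unfolding winnable_def by blast
      have "0 \<le> order_divisor (\<lambda>u. - p u) v - lap (\<lambda>v. f v + g v) v" if "v \<in> V" for v
        using g that order_divisor_reverse[OF p that] assms(2)[OF that]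
        by (fastforce simp: E'_def lap_add)
      then show False using order_divisor_unwinnable[of "\<lambda>u. - p u"] unfolding winnable_def by blast
    qed
  qed
qed

definition point :: "'v \<Rightarrow> 'v \<Rightarrow> int" where
  "point v u = (if u = v then 1 else 0)"

lemma lap_sum: "lap (\<lambda>u. \<Sum>i\<in>I. f i u) v = (\<Sum>i\<in>I. lap (f i) v)"
  by (induction I rule: infinite_finite_induct) (auto simp: lap_add)

lemma sum_point:
  assumes "v \<in> V"
  shows "(\<Sum>u\<in>V. c u * point u v) = c v"
proof -
  have "(\<Sum>u\<in>V. c u * point u v) = (\<Sum>u\<in>V. if v = u then c u else 0)"
    by (rule sum.cong) (auto simp: point_def)
  then show ?thesis using assms by simp
qed

lemma point_commute: "point u v = point v u"
  by (simp add: point_def)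

lemma sum_point': "v \<in> V \<Longrightarrow> (\<Sum>u\<in>V. c u * point v u) = c v"
  using sum_point[of v c] by (simp add: point_commute[of v])

lemma lap_eq_sum_point:
  assumes "v \<in> V"
  shows "lap f v = (\<Sum>u\<in>V. f u * lap (point u) v)"
proof -
  have "lap f v = lap (\<lambda>x. \<Sum>u\<in>V. f u * point u x) v"
    by (rule lap_cong[OF _ assms]) (simp add: sum_point)
  then show ?thesis by (simp add: lap_sum lap_scale)
qed

text \<open>
  Linear algebra in place of the matrix-tree theorem.  The Laplacians of the points other than \<open>q\<close>
  together with \<open>D\<close> are \<open>card V\<close> vectors, and their coordinate at \<open>q\<close> follows from the others since
  all degrees vanish; so there is a nontrivial relation.  The coefficient of \<open>D\<close> in it is nonzero,
  as a function killed by the Laplacian that vanishes at \<open>q\<close> is zero.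
\<close>

lemma degree_zero_imp_torsion:
  assumes "(\<Sum>v\<in>V. D v) = 0"
  obtains n :: nat and f where "0 < n" "\<And>v. v \<in> V \<Longrightarrow> int n * D v = lap f v"
proof -
  obtain q where q: "q \<in> V" using V_nonempty by blast
  \<comment> \<open>The slot of the omitted point \<open>q\<close> is taken by \<open>D\<close>.\<close>
  define M where "M s v = (if s = q then D v else lap (point s) v)" for s v
  have "card (V - {q}) < card V" using q by (intro psubset_card_mono) auto
  from ex_nontrivial_integer_relation[OF _ finite_V this, of M] obtain c where
    c: "\<exists>s\<in>V. c s \<noteq> 0" "\<forall>v\<in>V - {q}. (\<Sum>s\<in>V. c s * M s v) = 0" by auto
  define f where "f v = (if v = q then 0 else - c v)" for v
  have rel: "(\<Sum>s\<in>V. c s * M s v) = c q * D v - lap f v" if "v \<in> V" for v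
  proof -
    have "(\<Sum>s\<in>V. c s * M s v) = c q * D v + (\<Sum>s\<in>V - {q}. c s * lap (point s) v)"
      using q by (simp add: sum.remove M_def)
    also have "(\<Sum>s\<in>V - {q}. c s * lap (point s) v) = - (\<Sum>s\<in>V. f s * lap (point s) v)"
      using q by (simp add: sum.remove[of V q] f_def sum_negf)
    finally show ?thesis by (simp add: lap_eq_sum_point[OF that, of f])
  qed
  have off: "c q * D v = lap f v" if "v \<in> V - {q}" for v
    using c(2) that rel[of v] by auto
  have "c q * D q - lap f q = (\<Sum>v\<in>V. c q * D v - lap f v)"
    using off by (simp add: sum.remove[OF finite_V q])
  also have "\<dots> = 0" using assms by (simp add: sum_subtractf sum_distrib_left[symmetric])
  finally have eq: "c q * D v = lap f v" if "v \<in> V" for v using off that by (cases "v = q") auto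
  have "c q \<noteq> 0"
  proof
    assume "c q = 0"
    then obtain a where a: "\<And>v. v \<in> V \<Longrightarrow> f v = a" using harmonic_imp_constant[of f] eq by auto
    then have "a = 0" using a[OF q] by (simp add: f_def)
    then have "c v = 0" if "v \<in> V" for v using a[OF that] \<open>c q = 0\<close> by (auto simp: f_def split: if_splits)
    with c(1) show False by blast
  qed
  show ?thesis
  proof (cases "0 < c q")
    case True
    then show ?thesis using that[of "nat (c q)" f] eq by simp
  next
    case False
    then show ?thesis
      using that[of "nat (- c q)" "\<lambda>v. - f v"] eq \<open>c q \<noteq> 0\<close> by (simp add: lap_uminus)
  qed
qed

end



section \<open>Divisors of a connected multigraph\<close>

definition adjacency :: "('v,'e) pre_digraph \<Rightarrow> 'v \<Rightarrow> 'v \<Rightarrow> int" where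
  "adjacency G u v = (\<Sum>e\<in>arcs G. of_bool (tail G e = u \<and> head G e = v)
                                + of_bool (tail G e = v \<and> head G e = u))"

locale connected_multigraph = fin_digraph G + loopfree_digraph G
  for G :: "('v,'e) pre_digraph" (structure) +
  assumes connected: "Digraph_Component.connected G"
begin

lemma sum_adjacency:
  "(\<Sum>u\<in>verts G. adjacency G u v * F u)
     = (\<Sum>e\<in>arcs G. of_bool (head G e = v) * F (tail G e) + of_bool (tail G e = v) * F (head G e))"
proof -
  have "(\<Sum>u\<in>verts G. adjacency G u v * F u) = (\<Sum>e\<in>arcs G. \<Sum>u\<in>verts G.
      (of_bool (tail G e = u \<and> head G e = v) + of_bool (tail G e = v \<and> head G e = u)) * F u)"
    unfolding adjacency_def sum_distrib_right by (rule sum.swap)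
  also have "\<dots> = (\<Sum>e\<in>arcs G. of_bool (head G e = v) * F (tail G e) + of_bool (tail G e = v) * F (head G e))"
  proof (rule sum.cong[OF refl])
    fix e assume e: "e \<in> arcs G"
    have "(\<Sum>u\<in>verts G. (of_bool (tail G e = u \<and> head G e = v) + of_bool (tail G e = v \<and> head G e = u)) * F u)
      = (\<Sum>u\<in>verts G. (if tail G e = u then of_bool (head G e = v) * F u else 0)
          + (if head G e = u then of_bool (tail G e = v) * F u else 0))"
      by (rule sum.cong) auto
    then show "(\<Sum>u\<in>verts G. (of_bool (tail G e = u \<and> head G e = v) + of_bool (tail G e = v \<and> head G e = u)) * F u)
      = of_bool (head G e = v) * F (tail G e) + of_bool (tail G e = v) * F (head G e)"
      using e by (simp add: sum.distrib)
  qed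
  finally show ?thesis .
qed

lemma adjacency_pos_iff:
  "0 < adjacency G u v \<longleftrightarrow> (\<exists>e\<in>arcs G. tail G e = u \<and> head G e = v \<or> tail G e = v \<and> head G e = u)"
proof -
  have "adjacency G u v = 0 \<longleftrightarrow> \<not> (\<exists>e\<in>arcs G. tail G e = u \<and> head G e = v \<or> tail G e = v \<and> head G e = u)"
    unfolding adjacency_def by (subst sum_nonneg_eq_0_iff) (auto simp: add_nonneg_eq_0_iff)
  moreover have "0 \<le> adjacency G u v" unfolding adjacency_def by (simp add: sum_nonneg)
  ultimately show ?thesis by auto
qed

text \<open>
  A cut without edges would confine every walk that starts on one side to that side.  Loop-freeness
  enters through \<open>w v v = 0\<close>.
\<close>

sublocale connected_edge_weights "verts G" "adjacency G"
proof
  show "verts G \<noteq> {}" using connected by (simp add: connected_def strongly_connected_def)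
  show "0 \<le> adjacency G u v" for u v unfolding adjacency_def by (simp add: sum_nonneg)
  show "adjacency G u v = adjacency G v u" for u v unfolding adjacency_def by (simp add: add.commute)
  show "adjacency G v v = 0" for v
    unfolding adjacency_def using no_loops by (intro sum.neutral) force
  fix A assume A: "A \<subseteq> verts G" "A \<noteq> {}" "A \<noteq> verts G"
  then obtain a b where ab: "a \<in> A" "b \<in> verts G" "b \<notin> A" by auto
  show "\<exists>u\<in>A. \<exists>v\<in>verts G - A. 0 < adjacency G u v"
  proof (rule ccontr)
    assume no: "\<not> ?thesis"
    have "a \<rightarrow>\<^sup>*\<^bsub>with_proj (mk_symmetric G)\<^esub> b"
      using connected ab A by (auto simp: connected_def strongly_connected_def)
    then have "(a, b) \<in> rtrancl_on (verts G) (parcs (mk_symmetric G))"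
      by (simp add: reachable_def)
    then have "b \<in> A"
    proof (induction rule: rtrancl_on_induct)
      case (step y z)
      then have "0 < adjacency G y z" by (auto simp: adjacency_pos_iff parcs_mk_symmetric)
      with no step show ?case by blast
    qed (use ab in simp)
    with ab show False by simp
  qed
qed auto

lemma vertex_degree_eq: "int (vertex_degree G v) = (\<Sum>u\<in>verts G. adjacency G u v)"
proof -
  have "{e \<in> arcs G. head G e = v} = arcs G \<inter> {e. head G e = v}"
    "{e \<in> arcs G. tail G e = v} = arcs G \<inter> {e. tail G e = v}" by auto
  then show ?thesis
    using sum_adjacency[of v "\<lambda>_. 1"]
    by (simp add: vertex_degree_def in_degree_def out_degree_def in_arcs_def out_arcs_def sum.distrib)
qed

lemma sum_canon: "(\<Sum>v\<in>verts G. canon v) = 2 * (genus G - 1)"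
proof -
  have "(\<Sum>v\<in>verts G. \<Sum>u\<in>verts G. adjacency G u v) = (\<Sum>e\<in>arcs G. \<Sum>v\<in>verts G.
      of_bool (head G e = v) + of_bool (tail G e = v))"
    using sum_adjacency[of _ "\<lambda>_. 1"] by (simp add: sum.swap[of _ "verts G" "arcs G"])
  also have "\<dots> = (\<Sum>e\<in>arcs G. 2)"
  proof (rule sum.cong[OF refl])
    fix e assume "e \<in> arcs G"
    then show "(\<Sum>v\<in>verts G. of_bool (head G e = v) + of_bool (tail G e = v)) = (2 :: int)"
      by (simp add: sum.distrib of_bool_def)
  qed
  finally show ?thesis by (simp add: canon_def genus_def sum_subtractf)
qed

lemma lookup_boundary:
  assumes "Poly_Mapping.keys x \<subseteq> arcs G"
  shows "Poly_Mapping.lookup (boundary G x) v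
    = (\<Sum>e\<in>arcs G. Poly_Mapping.lookup x e * (of_bool (head G e = v) - of_bool (tail G e = v)))"
proof -
  have "Poly_Mapping.lookup (boundary G x) v
      = (\<Sum>e\<in>Poly_Mapping.keys x. Poly_Mapping.lookup x e * (of_bool (head G e = v) - of_bool (tail G e = v)))"
    unfolding boundary_def frag_extend_def
    by (auto simp: lookup_sum lookup_minus of_bool_def intro!: sum.cong)
  also have "\<dots> = (\<Sum>e\<in>arcs G. Poly_Mapping.lookup x e * (of_bool (head G e = v) - of_bool (tail G e = v)))"
    using assms by (intro sum.mono_neutral_left) (auto simp: in_keys_iff)
  finally show ?thesis .
qed

text \<open>
  The coboundary is the discrete gradient, so the Laplacian becomes a sum over edges of differences.
\<close>

lemma lookup_coboundary:
  "Poly_Mapping.lookup (coboundary G D) e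
    = (if e \<in> arcs G then Poly_Mapping.lookup D (head G e) - Poly_Mapping.lookup D (tail G e) else 0)"
proof -
  let ?d = "\<lambda>e v. of_bool (head G e = v) - of_bool (tail G e = v) :: int"
  have "Poly_Mapping.lookup (coboundary G D) e
      = (\<Sum>v\<in>Poly_Mapping.keys D. Poly_Mapping.lookup D v * (\<Sum>e'\<in>arcs G. ?d e' v * of_bool (e' = e)))"
    unfolding coboundary_def frag_extend_def
    by (auto simp: lookup_sum lookup_minus boundary_def of_bool_def intro!: sum.cong)
  also have "\<dots> = (\<Sum>v\<in>Poly_Mapping.keys D. Poly_Mapping.lookup D v * (if e \<in> arcs G then ?d e v else 0))"
  proof -
    have "(\<Sum>e'\<in>arcs G. ?d e' v * of_bool (e' = e)) = (\<Sum>e'\<in>arcs G. if e = e' then ?d e' v else 0)" for v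
      by (rule sum.cong) auto
    then show ?thesis by simp
  qed
  also have "\<dots> = (if e \<in> arcs G then (\<Sum>v\<in>Poly_Mapping.keys D. Poly_Mapping.lookup D v * ?d e v) else 0)"
    by simp
  also have "(\<Sum>v\<in>Poly_Mapping.keys D. Poly_Mapping.lookup D v * ?d e v)
      = Poly_Mapping.lookup D (head G e) - Poly_Mapping.lookup D (tail G e)"
  proof -
    have "(\<Sum>v\<in>Poly_Mapping.keys D. Poly_Mapping.lookup D v * of_bool (u = v))
        = (\<Sum>v\<in>Poly_Mapping.keys D. if u = v then Poly_Mapping.lookup D v else 0)" for u
      by (rule sum.cong) auto
    then show ?thesis by (simp add: right_diff_distrib sum_subtractf in_keys_iff)
  qed
  finally show ?thesis .
qed

lemma lookup_laplacian:
  "Poly_Mapping.lookup (laplacian G D) v = lap (Poly_Mapping.lookup D) v"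
proof -
  let ?l = "Poly_Mapping.lookup D"
  have "Poly_Mapping.keys (coboundary G D) \<subseteq> arcs G"
    by (auto simp: in_keys_iff lookup_coboundary split: if_splits)
  then have "Poly_Mapping.lookup (laplacian G D) v
      = (\<Sum>e\<in>arcs G. (?l (head G e) - ?l (tail G e)) * (of_bool (head G e = v) - of_bool (tail G e = v)))"
    unfolding laplacian_def by (simp add: lookup_boundary lookup_coboundary)
  also have "\<dots> = (\<Sum>e\<in>arcs G. of_bool (head G e = v) * (?l v - ?l (tail G e))
                              + of_bool (tail G e = v) * (?l v - ?l (head G e)))"
    by (rule sum.cong) auto
  also have "\<dots> = lap ?l v" unfolding lap_def sum_adjacency ..
  finally show ?thesis .
qed

lemma keys_laplacian: "Poly_Mapping.keys (laplacian G D) \<subseteq> verts G"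
proof
  fix v assume "v \<in> Poly_Mapping.keys (laplacian G D)"
  then have "lap (Poly_Mapping.lookup D) v \<noteq> 0" by (simp add: in_keys_iff lookup_laplacian)
  then have "\<exists>e\<in>arcs G. head G e = v \<or> tail G e = v"
    unfolding lap_def sum_adjacency by (rule contrapos_np) (auto intro!: sum.neutral)
  then show "v \<in> verts G" by auto
qed

definition divisor_of :: "('v \<Rightarrow> int) \<Rightarrow> ('v \<Rightarrow>\<^sub>0 int)" where
  "divisor_of f = (\<Sum>v\<in>verts G. frag_cmul (f v) (frag_of v))"

lemma lookup_divisor_of: "Poly_Mapping.lookup (divisor_of f) v = (if v \<in> verts G then f v else 0)"
proof -
  have "Poly_Mapping.lookup (divisor_of f) v = (\<Sum>u\<in>verts G. if v = u then f u else 0)"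
    unfolding divisor_of_def lookup_sum by (rule sum.cong) auto
  then show ?thesis by simp
qed

lemma keys_divisor_of: "Poly_Mapping.keys (divisor_of f) \<subseteq> verts G"
  by (auto simp: in_keys_iff lookup_divisor_of split: if_splits)

lemma lookup_canonical:
  "v \<in> verts G \<Longrightarrow> Poly_Mapping.lookup (canonical_divisor G) v = canon v"
  using lookup_divisor_of[of "\<lambda>v. int (vertex_degree G v) - 2" v]
  by (simp add: divisor_of_def canonical_divisor_def canon_def vertex_degree_eq)

lemma lookup_indicator: "Poly_Mapping.lookup (indicator_divisor E) v = int (count E v)"
  unfolding indicator_divisor_def by (induction E) (auto simp: lookup_add)

text \<open>
  The bridge from the rank of a divisor to the game on functions.
\<close>

lemma effective_mod_Prin_iff_winnable:
  "(\<exists>\<phi>\<in>carrier (Prin G). effective G (D - \<phi> - indicator_divisor E))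
    \<longleftrightarrow> winnable (\<lambda>v. Poly_Mapping.lookup D v - int (count E v))"
proof
  assume "\<exists>\<phi>\<in>carrier (Prin G). effective G (D - \<phi> - indicator_divisor E)"
  then obtain x where "effective G (D - laplacian G x - indicator_divisor E)"
    by (auto simp: Prin_def)
  then show "winnable (\<lambda>v. Poly_Mapping.lookup D v - int (count E v))"
    unfolding winnable_def effective_def
    by (intro exI[of _ "Poly_Mapping.lookup x"]) (auto simp: lookup_minus lookup_indicator lookup_laplacian)
next
  assume "winnable (\<lambda>v. Poly_Mapping.lookup D v - int (count E v))"
  then obtain f where f: "\<forall>v\<in>verts G. 0 \<le> Poly_Mapping.lookup D v - int (count E v) - lap f v"
    unfolding winnable_def by blast
  have "lap (Poly_Mapping.lookup (divisor_of f)) v = lap f v" if "v \<in> verts G" for v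
    by (rule lap_cong[OF _ that]) (simp add: lookup_divisor_of)
  then have "effective G (D - laplacian G (divisor_of f) - indicator_divisor E)"
    using f by (force simp: effective_def lookup_minus lookup_indicator lookup_laplacian)
  then show "\<exists>\<phi>\<in>carrier (Prin G). effective G (D - \<phi> - indicator_divisor E)"
    using keys_divisor_of by (auto simp: Prin_def Div_def)
qed

section \<open>Riemann--Roch\<close>

definition rank_at_least :: "('v \<Rightarrow>\<^sub>0 int) \<Rightarrow> int \<Rightarrow> bool" where
  "rank_at_least D k \<longleftrightarrow> (\<forall>E. set_mset E \<subseteq> verts G \<and> int (size E) = k \<longrightarrow>
     winnable (\<lambda>v. Poly_Mapping.lookup D v - int (count E v)))"

lemma winnable_imp_degree_nonneg: "winnable D \<Longrightarrow> 0 \<le> (\<Sum>v\<in>verts G. D v)"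
proof -
  assume "winnable D"
  then obtain f where "\<forall>v\<in>verts G. 0 \<le> D v - lap f v" unfolding winnable_def by blast
  then have "0 \<le> (\<Sum>v\<in>verts G. D v - lap f v)" by (intro sum_nonneg) auto
  then show ?thesis by (simp add: sum_subtractf)
qed

lemma sum_count:
  assumes "set_mset E \<subseteq> verts G"
  shows "(\<Sum>v\<in>verts G. int (count E v)) = int (size E)"
proof -
  have "size E = (\<Sum>v\<in>verts G. count E v)"
    unfolding size_multiset_overloaded_eq using assms
    by (intro sum.mono_neutral_left) (auto simp: not_in_iff)
  then show ?thesis by simp
qed

text \<open>
  The maximum in the rank exists, since removing more chips than the degree leaves negative degree.
  The three properties say that it is the largest admissible value.
\<close>

lemma divisor_rank_props:
  shows "-1 \<le> divisor_rank G D" "rank_at_least D (divisor_rank G D)"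
    "\<not> rank_at_least D (divisor_rank G D + 1)"
proof -
  define S where "S = {k. -1 \<le> k \<and> rank_at_least D k}"
  have rank: "divisor_rank G D = Max S"
    unfolding divisor_rank_def S_def rank_at_least_def effective_mod_Prin_iff_winnable ..
  have "S \<subseteq> {-1..max (-1) (divisor_deg G D)}"
  proof
    fix k assume k: "k \<in> S"
    show "k \<in> {-1..max (-1) (divisor_deg G D)}"
    proof (cases "k < 0")
      case False
      obtain q where q: "q \<in> verts G" using V_nonempty by blast
      \<comment> \<open>Only one vertex is at hand for certain, so all \<open>k\<close> chips are removed there.\<close>
      let ?E = "replicate_mset (nat k) q"
      have E: "set_mset ?E \<subseteq> verts G" "int (size ?E) = k" using q False by auto
      then have "winnable (\<lambda>v. Poly_Mapping.lookup D v - int (count ?E v))"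
        using k unfolding S_def rank_at_least_def by blast
      from winnable_imp_degree_nonneg[OF this] sum_count[OF E(1)] E(2)
      have "k \<le> divisor_deg G D" by (simp only: sum_subtractf divisor_deg_def)
      then show ?thesis using False by simp
    qed (use k in \<open>simp add: S_def\<close>)
  qed
  then have fin: "finite S" by (rule finite_subset) simp
  have "-1 \<in> S" by (simp add: S_def rank_at_least_def)
  then have "Max S \<in> S" using fin by (intro Max_in) auto
  then show "-1 \<le> divisor_rank G D" "rank_at_least D (divisor_rank G D)"
    by (auto simp: rank S_def)
  show "\<not> rank_at_least D (divisor_rank G D + 1)"
  proof
    assume "rank_at_least D (divisor_rank G D + 1)"
    then have "Max S + 1 \<in> S" using \<open>Max S \<in> S\<close> by (simp add: rank S_def)
    then show False using Max_ge[OF fin] by fastforce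
  qed
qed

lemma rank_at_least_antimono:
  assumes "rank_at_least D k" "0 \<le> j" "j \<le> k"
  shows "rank_at_least D j"
  unfolding rank_at_least_def
proof (intro allI impI, elim conjE)
  fix E assume E: "set_mset E \<subseteq> verts G" "int (size E) = j"
  obtain q where q: "q \<in> verts G" using V_nonempty by blast
  let ?E = "E + replicate_mset (nat (k - j)) q"
  have "set_mset ?E \<subseteq> verts G" "int (size ?E) = k" using E q assms by auto
  then have "winnable (\<lambda>v. Poly_Mapping.lookup D v - int (count ?E v))"
    using assms unfolding rank_at_least_def by blast
  then obtain f where "\<forall>v\<in>verts G. 0 \<le> Poly_Mapping.lookup D v - int (count ?E v) - lap f v"
    unfolding winnable_def by blast
  then have "\<forall>v\<in>verts G. 0 \<le> Poly_Mapping.lookup D v - int (count E v) - lap f v"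
    by fastforce
  then show "winnable (\<lambda>v. Poly_Mapping.lookup D v - int (count E v))"
    unfolding winnable_def by blast
qed

text \<open>
  Take \<open>E\<close> of degree \<open>r(D) + 1\<close> with \<open>D - E\<close> unwinnable.  The dual divisor \<open>E'\<close> shows that
  \<open>r(K - D) < deg E' = r(D) + 1 - deg D + g - 1\<close>.
\<close>

lemma Riemann_Roch_inequality:
  "divisor_deg G D + 1 - genus G \<le> divisor_rank G D - divisor_rank G (canonical_divisor G - D)"
proof -
  let ?d = "Poly_Mapping.lookup D"
  let ?r = "divisor_rank G D" and ?r' = "divisor_rank G (canonical_divisor G - D)"
  obtain E where E: "set_mset E \<subseteq> verts G" "int (size E) = ?r + 1"
    "\<not> winnable (\<lambda>v. ?d v - int (count E v))"
    using divisor_rank_props(3)[of D] unfolding rank_at_least_def by blast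
  obtain F where F: "\<And>v. v \<in> verts G \<Longrightarrow> 0 \<le> F v" "\<not> winnable (\<lambda>v. canon v - ?d v - F v)"
    "2 * (\<Sum>v\<in>verts G. F v) = 2 * (\<Sum>v\<in>verts G. int (count E v)) - 2 * (\<Sum>v\<in>verts G. ?d v)
       + (\<Sum>v\<in>verts G. canon v)"
    using unwinnable_dual[OF E(3)] by auto
  define E' where "E' = (\<Sum>v\<in>verts G. replicate_mset (nat (F v)) v)"
  have count_E': "int (count E' v) = (if v \<in> verts G then F v else 0)" for v
    using F(1) by (simp add: E'_def count_sum)
  have set_E': "set_mset E' \<subseteq> verts G"
    using count_E' by (metis count_eq_zero_iff of_nat_eq_0_iff subsetI)
  have "2 * int (size E') = 2 * (?r + 1) - 2 * divisor_deg G D + 2 * (genus G - 1)"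
    using F(3) sum_count[OF E(1)] sum_count[OF set_E'] E(2) sum_canon
    by (simp add: count_E' divisor_deg_def)
  then have size_E': "int (size E') = ?r - divisor_deg G D + genus G" by simp
  have "?r' < int (size E')"
  proof (rule ccontr)
    assume "\<not> ?thesis"
    then have "rank_at_least (canonical_divisor G - D) (int (size E'))"
      by (intro rank_at_least_antimono[OF divisor_rank_props(2)]) auto
    then have "winnable (\<lambda>v. Poly_Mapping.lookup (canonical_divisor G - D) v - int (count E' v))"
      using set_E' unfolding rank_at_least_def by blast
    then show False using F(2) by (simp add: winnable_def lookup_minus lookup_canonical count_E')
  qed
  then show ?thesis using size_E' by simp
qed

text \<open>
  The inequality for \<open>D\<close> and the inequality for \<open>K - D\<close> are opposite to each other, because
  \<open>deg K = 2 g - 2\<close>.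
\<close>

theorem Riemann_Roch:
  "divisor_rank G D - divisor_rank G (canonical_divisor G - D) = divisor_deg G D + 1 - genus G"
proof -
  have "divisor_deg G (canonical_divisor G - D) = 2 * (genus G - 1) - divisor_deg G D"
    by (simp add: divisor_deg_def lookup_minus sum_subtractf lookup_canonical sum_canon)
  moreover have "canonical_divisor G - (canonical_divisor G - D) = D" by simp
  ultimately show ?thesis
    using Riemann_Roch_inequality[of D] Riemann_Roch_inequality[of "canonical_divisor G - D"] by simp
qed

end



section \<open>Integer duals of abelian groups\<close>

lemma comm_group_dual_group:
  assumes "group A"
  shows "comm_group (dual_group A)"
proof (rule comm_groupI)
  interpret group A by fact
  fix f assume f: "f \<in> carrier (dual_group A)"
  then have "(\<lambda>x\<in>carrier A. - f x) \<in> carrier (dual_group A)"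
    by (auto simp: dual_group_def hom_def)
  moreover have "(\<lambda>x\<in>carrier A. - f x) \<otimes>\<^bsub>dual_group A\<^esub> f = \<one>\<^bsub>dual_group A\<^esub>"
    by (auto simp: dual_group_def)
  ultimately show "\<exists>g\<in>carrier (dual_group A). g \<otimes>\<^bsub>dual_group A\<^esub> f = \<one>\<^bsub>dual_group A\<^esub>" by blast
next
  interpret group A by fact
  show "\<one>\<^bsub>dual_group A\<^esub> \<in> carrier (dual_group A)"
    by (auto simp: dual_group_def hom_def)
  fix f g assume "f \<in> carrier (dual_group A)" "g \<in> carrier (dual_group A)"
  then show "f \<otimes>\<^bsub>dual_group A\<^esub> g \<in> carrier (dual_group A)"
    by (auto simp: dual_group_def hom_def)
qed (auto simp: dual_group_def extensional_def intro!: ext)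

lemma dual_group_eqI:
  assumes "f \<in> carrier (dual_group A)" "g \<in> carrier (dual_group A)"
    and "\<And>x. x \<in> carrier A \<Longrightarrow> f x = g x"
  shows "f = g"
  using assms by (auto simp: dual_group_def intro: extensionalityI)

lemma one_in_dual_group:
  assumes "group A"
  shows "\<one>\<^bsub>dual_group A\<^esub> \<in> carrier (dual_group A)"
proof -
  interpret comm_group "dual_group A" by (rule comm_group_dual_group[OF assms])
  show ?thesis by (rule one_closed)
qed

lemma eval_hom_dual_group:
  assumes "x \<in> carrier A"
  shows "(\<lambda>f. f x) \<in> hom (dual_group A) integer_group"
  using assms by (auto simp: dual_group_def hom_def)

lemma group_hom_dual_map:
  assumes "group A" "group B" "h \<in> hom A B"
  shows "group_hom (dual_group B) (dual_group A) (dual_map A h)"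
proof -
  interpret A: group A by fact
  interpret B: group B by fact
  have h: "h x \<in> carrier B" "h (x \<otimes>\<^bsub>A\<^esub> y) = h x \<otimes>\<^bsub>B\<^esub> h y"
    if "x \<in> carrier A" "y \<in> carrier A" for x y
    using assms(3) that by (auto simp: hom_def)
  have "dual_map A h \<in> hom (dual_group B) (dual_group A)"
    by (rule homI) (auto simp: dual_group_def dual_map_def hom_def Pi_iff h intro!: ext)
  then show ?thesis
    using comm_group_dual_group[OF assms(1)] comm_group_dual_group[OF assms(2)]
    by (simp add: group_hom_def group_hom_axioms_def comm_group_def)
qed

section \<open>The rank of an abelian group\<close>

lemma hom_finprod_int_pow:
  assumes "comm_group A" "\<phi> \<in> hom A integer_group" "finite S" "S \<subseteq> carrier A"
  shows "\<phi> (finprod A (\<lambda>s. s [^]\<^bsub>A\<^esub> (c s :: int)) S) = (\<Sum>s\<in>S. c s * \<phi> s)"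
proof -
  interpret comm_group A by fact
  interpret group_hom A integer_group \<phi>
    using assms(2) is_group by (simp add: group_hom_def group_hom_axioms_def)
  show ?thesis using assms(3,4)
  proof (induction S rule: finite_induct)
    case empty
    then show ?case using hom_one by simp
  next
    case (insert s S)
    then have "finprod A (\<lambda>s. s [^]\<^bsub>A\<^esub> c s) (insert s S)
        = s [^]\<^bsub>A\<^esub> c s \<otimes>\<^bsub>A\<^esub> finprod A (\<lambda>s. s [^]\<^bsub>A\<^esub> c s) S"
      by (intro finprod_insert) auto
    moreover have "finprod A (\<lambda>s. s [^]\<^bsub>A\<^esub> c s) S \<in> carrier A"
      using insert by (intro finprod_closed) auto
    ultimately show ?case using insert by (simp add: hom_int_pow)
  qed
qed

text \<open>
  A perfect pairing over the rationals determines the rank.  The functionals \<open>\<phi> i\<close> embed \<open>A\<close> into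
  integer vectors with \<open>card I\<close> coordinates, which bounds independent sets; nondegeneracy of the
  matrix \<open>\<phi> j (b i)\<close> makes the elements \<open>b i\<close> distinct and independent, so the bound is attained.
\<close>

lemma abelian_rank_eqI:
  assumes A: "comm_group A" and I: "finite I"
    and hom: "\<And>i. i \<in> I \<Longrightarrow> \<phi> i \<in> hom A integer_group"
    and separate: "\<And>x. x \<in> carrier A \<Longrightarrow> (\<And>i. i \<in> I \<Longrightarrow> \<phi> i x = 0) \<Longrightarrow> x = \<one>\<^bsub>A\<^esub>"
    and b: "\<And>i. i \<in> I \<Longrightarrow> b i \<in> carrier A"
    and nondeg: "\<And>c i. (\<And>j. j \<in> I \<Longrightarrow> (\<Sum>i\<in>I. c i * \<phi> j (b i)) = 0) \<Longrightarrow> i \<in> I \<Longrightarrow> c i = 0"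
  shows "abelian_rank A = card I"
proof -
  interpret comm_group A by fact
  have inj: "inj_on b I"
  proof (rule inj_onI, rule ccontr)
    fix i k assume ik: "i \<in> I" "k \<in> I" "b i = b k" "i \<noteq> k"
    \<comment> \<open>If two of the elements agreed, their difference would be a relation between the columns.\<close>
    define c where "c x = (if x = i then 1 else 0) - (if x = k then 1 else 0 :: int)" for x
    have "(\<Sum>x\<in>I. c x * \<phi> j (b x)) = 0" for j
    proof -
      have "(\<Sum>x\<in>I. c x * \<phi> j (b x))
          = (\<Sum>x\<in>I. (if x = i then \<phi> j (b x) else 0) - (if x = k then \<phi> j (b x) else 0))"
        by (rule sum.cong) (auto simp: c_def)
      then show ?thesis using ik I by (simp add: sum_subtractf)
    qed
    from nondeg[of c, OF this ik(1)] ik show False by (simp add: c_def)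
  qed
  have "int_independent A (b ` I)"
    unfolding int_independent_def
  proof (intro allI impI ballI)
    fix c :: "'a \<Rightarrow> int" and s
    assume eq: "finprod A (\<lambda>s. s [^]\<^bsub>A\<^esub> c s) (b ` I) = \<one>\<^bsub>A\<^esub>" and s: "s \<in> b ` I"
    have "(\<Sum>i\<in>I. c (b i) * \<phi> j (b i)) = 0" if j: "j \<in> I" for j
    proof -
      interpret h: group_hom A integer_group "\<phi> j"
        using hom[OF j] is_group by (simp add: group_hom_def group_hom_axioms_def)
      have "0 = \<phi> j (finprod A (\<lambda>s. s [^]\<^bsub>A\<^esub> c s) (b ` I))"
        using eq h.hom_one by simp
      also have "\<dots> = (\<Sum>s\<in>b ` I. c s * \<phi> j s)"
        using b I by (intro hom_finprod_int_pow[OF A hom[OF j]]) auto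
      also have "\<dots> = (\<Sum>i\<in>I. c (b i) * \<phi> j (b i))" using inj by (simp add: sum.reindex)
      finally show ?thesis by simp
    qed
    from nondeg[of "\<lambda>i. c (b i)", OF this] s show "c s = 0" by auto
  qed
  moreover have "card (b ` I) = card I" using inj by (rule card_image)
  ultimately have attained: "card I \<in> {card S | S. finite S \<and> S \<subseteq> carrier A \<and> int_independent A S}"
    using b I by (intro CollectI exI[of _ "b ` I"]) auto
  have "card S \<le> card I" if S: "finite S" "S \<subseteq> carrier A" "int_independent A S" for S
  proof (rule ccontr)
    assume "\<not> card S \<le> card I"
    then obtain c where c: "\<exists>s\<in>S. c s \<noteq> 0" "\<forall>i\<in>I. (\<Sum>s\<in>S. c s * \<phi> i s) = 0"
      using ex_nontrivial_integer_relation[OF I S(1), of "\<lambda>s i. \<phi> i s"] by auto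
    have "finprod A (\<lambda>s. s [^]\<^bsub>A\<^esub> c s) S = \<one>\<^bsub>A\<^esub>"
    proof (rule separate)
      show "finprod A (\<lambda>s. s [^]\<^bsub>A\<^esub> c s) S \<in> carrier A"
        using S by (intro finprod_closed) auto
      show "\<phi> i (finprod A (\<lambda>s. s [^]\<^bsub>A\<^esub> c s) S) = 0" if "i \<in> I" for i
        using c(2) that by (simp add: hom_finprod_int_pow[OF A hom[OF that] S(1,2)])
    qed
    with S(3) c(1) show False unfolding int_independent_def by blast
  qed
  with attained show ?thesis
    unfolding abelian_rank_def by (intro cSup_eq_maximum) auto
qed

section \<open>Divisors, principal divisors and their duals\<close>

context connected_multigraph
begin

lemma comm_group_Div: "comm_group (Div G)"
  unfolding Div_def by (rule abelian_free_Abelian_group)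

lemma group_Div: "group (Div G)"
  unfolding Div_def by (rule group_free_Abelian_group)

lemma carrier_Div: "D \<in> carrier (Div G) \<longleftrightarrow> Poly_Mapping.keys D \<subseteq> verts G"
  by (simp add: Div_def)

lemma mult_Div [simp]: "x \<otimes>\<^bsub>Div G\<^esub> y = x + y"
  by (simp add: Div_def)

lemma one_Div [simp]: "\<one>\<^bsub>Div G\<^esub> = 0"
  by (simp add: Div_def)

lemma divisor_of_in_Div [simp]: "divisor_of f \<in> carrier (Div G)"
  by (simp add: carrier_Div keys_divisor_of)

lemma frag_of_in_Div: "v \<in> verts G \<Longrightarrow> frag_of v \<in> carrier (Div G)"
  by (simp add: carrier_Div)

lemma laplacian_in_Div [simp]: "laplacian G x \<in> carrier (Div G)"
  by (simp add: carrier_Div keys_laplacian)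

lemma Div_eqI:
  assumes "x \<in> carrier (Div G)" "y \<in> carrier (Div G)"
    and "\<And>v. v \<in> verts G \<Longrightarrow> Poly_Mapping.lookup x v = Poly_Mapping.lookup y v"
  shows "x = y"
proof (rule poly_mapping_eqI)
  fix v show "Poly_Mapping.lookup x v = Poly_Mapping.lookup y v"
    using assms by (cases "v \<in> verts G") (auto simp: carrier_Div in_keys_iff subset_iff dest: spec[of _ v])
qed

lemma laplacian_add: "laplacian G (x + y) = laplacian G x + laplacian G y"
proof (rule poly_mapping_eqI)
  have "Poly_Mapping.lookup (x + y) = (\<lambda>v. Poly_Mapping.lookup x v + Poly_Mapping.lookup y v)"
    by (rule ext) (rule lookup_add)
  then show "Poly_Mapping.lookup (laplacian G (x + y)) v
      = Poly_Mapping.lookup (laplacian G x + laplacian G y) v" for v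
    by (simp add: lookup_laplacian lookup_add lap_add)
qed

lemma laplacian_hom: "laplacian G \<in> hom (Div G) (Div G)"
  by (auto simp: hom_def laplacian_add)

lemma lap_lookup_divisor_of:
  "v \<in> verts G \<Longrightarrow> lap (Poly_Mapping.lookup (divisor_of f)) v = lap f v"
  by (rule lap_cong) (auto simp: lookup_divisor_of)

lemma laplacian_divisor_of_eqI:
  assumes "D \<in> carrier (Div G)" "\<And>v. v \<in> verts G \<Longrightarrow> Poly_Mapping.lookup D v = lap f v"
  shows "D = laplacian G (divisor_of f)"
  using assms by (intro Div_eqI) (auto simp: lookup_laplacian lap_lookup_divisor_of)

lemma in_Prin_iff:
  assumes "D \<in> carrier (Div G)"
  shows "D \<in> carrier (Prin G) \<longleftrightarrow> (\<exists>f. \<forall>v\<in>verts G. Poly_Mapping.lookup D v = lap f v)"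
proof
  assume "D \<in> carrier (Prin G)"
  then show "\<exists>f. \<forall>v\<in>verts G. Poly_Mapping.lookup D v = lap f v"
    by (auto simp: Prin_def lookup_laplacian)
next
  assume "\<exists>f. \<forall>v\<in>verts G. Poly_Mapping.lookup D v = lap f v"
  then obtain f where "D = laplacian G (divisor_of f)"
    using laplacian_divisor_of_eqI[OF assms] by blast
  then show "D \<in> carrier (Prin G)" by (simp add: Prin_def)
qed

lemma laplacian_in_Prin [simp]: "x \<in> carrier (Div G) \<Longrightarrow> laplacian G x \<in> carrier (Prin G)"
  by (simp add: Prin_def)

lemma subgroup_Prin: "subgroup (carrier (Prin G)) (Div G)"
proof -
  interpret group_hom "Div G" "Div G" "laplacian G"
    using group_Div laplacian_hom by (simp add: group_hom_def group_hom_axioms_def)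
  show ?thesis using img_is_subgroup by (simp add: Prin_def)
qed

lemma group_Prin: "group (Prin G)"
  using group.subgroup_imp_group[OF group_Div subgroup_Prin] by (simp add: Prin_def)

lemma Prin_subset: "carrier (Prin G) \<subseteq> carrier (Div G)"
  using subgroup_Prin by (rule subgroup.subset)

lemma mult_Prin [simp]: "x \<otimes>\<^bsub>Prin G\<^esub> y = x + y"
  by (simp add: Prin_def)

lemma inclusion_hom: "(\<lambda>D. D) \<in> hom (Prin G) (Div G)"
  using Prin_subset by (auto simp: hom_def)

lemma divisor_deg_hom: "divisor_deg G \<in> hom (Div G) integer_group"
  by (auto simp: hom_def divisor_deg_def lookup_add sum.distrib)

lemma hom_Div_expand:
  assumes "f \<in> hom (Div G) integer_group" "x \<in> carrier (Div G)"
  shows "f x = (\<Sum>v\<in>verts G. Poly_Mapping.lookup x v * f (frag_of v))"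
proof -
  have add: "f (a + b) = f a + f b" if "a \<in> carrier (Div G)" "b \<in> carrier (Div G)" for a b
    using assms(1) that by (auto simp: hom_def)
  have "Poly_Mapping.keys x \<subseteq> verts G" using assms(2) by (simp add: carrier_Div)
  then show ?thesis
  proof (rule free_Abelian_group_induct[where
        P = "\<lambda>x. f x = (\<Sum>v\<in>verts G. Poly_Mapping.lookup x v * f (frag_of v))"])
    show "f 0 = (\<Sum>v\<in>verts G. Poly_Mapping.lookup 0 v * f (frag_of v))"
      using add[of 0 0] by (simp add: carrier_Div)
  next
    fix x y :: "'v \<Rightarrow>\<^sub>0 int"
    assume xy: "Poly_Mapping.keys x \<subseteq> verts G" "Poly_Mapping.keys y \<subseteq> verts G"
      and eq: "f x = (\<Sum>v\<in>verts G. Poly_Mapping.lookup x v * f (frag_of v))"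
        "f y = (\<Sum>v\<in>verts G. Poly_Mapping.lookup y v * f (frag_of v))"
    have "Poly_Mapping.keys (x - y) \<subseteq> verts G"
      using xy keys_diff[of x y] by auto
    then have "f (x - y) = f x - f y" using add[of "x - y" y] xy by (simp add: carrier_Div)
    then show "f (x - y) = (\<Sum>v\<in>verts G. Poly_Mapping.lookup (x - y) v * f (frag_of v))"
      by (simp add: eq lookup_minus left_diff_distrib sum_subtractf)
  next
    fix a assume a: "a \<in> verts G"
    have "(\<Sum>v\<in>verts G. Poly_Mapping.lookup (frag_of a) v * f (frag_of v))
        = (\<Sum>v\<in>verts G. if a = v then f (frag_of v) else 0)"
      by (rule sum.cong) auto
    then show "f (frag_of a) = (\<Sum>v\<in>verts G. Poly_Mapping.lookup (frag_of a) v * f (frag_of v))"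
      using a by simp
  qed
qed

lemma linear_in_hom_Div:
  "(\<lambda>D. \<Sum>v\<in>verts G. F v * Poly_Mapping.lookup D v) \<in> hom (Div G) integer_group"
  by (auto simp: hom_def lookup_add distrib_left sum.distrib)

lemma lookup_frag_of_point: "Poly_Mapping.lookup (frag_of v) = point v"
  by (auto simp: point_def)

text \<open>
  The dual of \<open>Prin G\<close> is identified with the divisors of degree zero: \<open>f\<close> corresponds to the
  divisor with value \<open>f (L v)\<close> at \<open>v\<close>, where \<open>L\<close> is the Laplacian.
\<close>

definition weight :: "(('v \<Rightarrow>\<^sub>0 int) \<Rightarrow> int) \<Rightarrow> 'v \<Rightarrow> int" where
  "weight f v = f (laplacian G (frag_of v))"

lemma hom_Prin_laplacian:
  assumes "f \<in> carrier (dual_group (Prin G))" "x \<in> carrier (Div G)"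
  shows "f (laplacian G x) = (\<Sum>v\<in>verts G. Poly_Mapping.lookup x v * weight f v)"
proof -
  have "(\<lambda>x. f (laplacian G x)) \<in> hom (Div G) integer_group"
    using assms(1) by (auto simp: dual_group_def hom_def laplacian_add)
  from hom_Div_expand[OF this assms(2)] show ?thesis by (simp add: weight_def)
qed

text \<open>
  The Laplacians of all vertices add up to zero.
\<close>

lemma sum_weight:
  assumes "f \<in> carrier (dual_group (Prin G))"
  shows "(\<Sum>v\<in>verts G. weight f v) = 0"
proof -
  have "lap (Poly_Mapping.lookup 0) v = 0" for v by (simp add: lap_def)
  then have "laplacian G (divisor_of (\<lambda>_. 1)) = laplacian G 0"
    by (intro Div_eqI) (auto simp: lookup_laplacian lap_lookup_divisor_of)
  then show ?thesis
    using hom_Prin_laplacian[OF assms, of "divisor_of (\<lambda>_. 1)"] hom_Prin_laplacian[OF assms, of 0]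
    by (simp add: lookup_divisor_of carrier_Div keys_divisor_of)
qed

lemma weight_determines:
  assumes "f \<in> carrier (dual_group (Prin G))" "g \<in> carrier (dual_group (Prin G))"
    and "\<And>v. v \<in> verts G \<Longrightarrow> weight f v = weight g v"
  shows "f = g"
proof (rule dual_group_eqI[OF assms(1,2)])
  fix y assume "y \<in> carrier (Prin G)"
  then obtain x where "x \<in> carrier (Div G)" "y = laplacian G x" by (auto simp: Prin_def)
  then show "f y = g y" using assms by (simp add: hom_Prin_laplacian)
qed

text \<open>
  The functional is \<open>L x \<mapsto> \<Sum> F v \<cdot> x v\<close>.  It is well defined: two preimages of a principal divisor
  differ by a constant, and \<open>F\<close> pairs to zero with constants.
\<close>

lemma ex_weight:
  assumes "(\<Sum>v\<in>verts G. F v) = 0"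
  obtains f where "f \<in> carrier (dual_group (Prin G))" "\<And>v. v \<in> verts G \<Longrightarrow> weight f v = F v"
proof -
  define pre where "pre y = (SOME x. x \<in> carrier (Div G) \<and> laplacian G x = y)" for y
  define f where "f = (\<lambda>y\<in>carrier (Prin G). \<Sum>v\<in>verts G. F v * Poly_Mapping.lookup (pre y) v)"
  have f_lap: "f (laplacian G x) = (\<Sum>v\<in>verts G. F v * Poly_Mapping.lookup x v)"
    if x: "x \<in> carrier (Div G)" for x
  proof -
    let ?z = "pre (laplacian G x)"
    have z: "?z \<in> carrier (Div G) \<and> laplacian G ?z = laplacian G x"
      unfolding pre_def by (rule someI[of _ x]) (use x in simp)
    have "lap (\<lambda>v. Poly_Mapping.lookup ?z v - Poly_Mapping.lookup x v) v = 0" for v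
      using z by (simp add: lap_diff flip: lookup_laplacian)
    then obtain c where c: "\<And>v. v \<in> verts G \<Longrightarrow> Poly_Mapping.lookup ?z v - Poly_Mapping.lookup x v = c"
      using harmonic_imp_constant[of "\<lambda>v. Poly_Mapping.lookup ?z v - Poly_Mapping.lookup x v"] by auto
    have "(\<Sum>v\<in>verts G. F v * Poly_Mapping.lookup ?z v) - (\<Sum>v\<in>verts G. F v * Poly_Mapping.lookup x v)
        = (\<Sum>v\<in>verts G. F v * c)"
      unfolding sum_subtractf[symmetric] by (rule sum.cong) (auto simp: c simp flip: right_diff_distrib)
    also have "\<dots> = 0" using assms by (simp add: sum_distrib_right[symmetric])
    finally show ?thesis using x by (simp add: f_def)
  qed
  have "f \<in> hom (Prin G) integer_group"
  proof (rule homI)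
    fix y z assume "y \<in> carrier (Prin G)" "z \<in> carrier (Prin G)"
    then obtain a b where ab: "a \<in> carrier (Div G)" "b \<in> carrier (Div G)"
      "y = laplacian G a" "z = laplacian G b" by (auto simp: Prin_def)
    have "a + b \<in> carrier (Div G)"
      using ab monoid.m_closed[OF group.is_monoid[OF group_Div], of a b] by simp
    then show "f (y \<otimes>\<^bsub>Prin G\<^esub> z) = f y \<otimes>\<^bsub>integer_group\<^esub> f z"
      using ab by (simp add: f_lap lookup_add distrib_left sum.distrib flip: laplacian_add)
  qed simp
  then have "f \<in> carrier (dual_group (Prin G))" by (simp add: dual_group_def f_def)
  moreover have "weight f v = F v" if "v \<in> verts G" for v
    using that by (simp add: weight_def f_lap frag_of_in_Div lookup_frag_of_point sum_point' del: lookup_frag_of)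
  ultimately show ?thesis using that by blast
qed

text \<open>
  Under the identification of the dual of \<open>Prin G\<close> with divisors of degree zero, and of the dual of
  \<open>Div G\<close> with integer functions on the vertices, restriction of functionals becomes the Laplacian,
  because the Laplacian is self-adjoint.
\<close>

lemma weight_restriction:
  assumes "g \<in> hom (Div G) integer_group" "v \<in> verts G"
  shows "weight (dual_map (Prin G) (\<lambda>D. D) g) v = lap (\<lambda>u. g (frag_of u)) v"
proof -
  let ?F = "\<lambda>u. g (frag_of u)"
  have "weight (dual_map (Prin G) (\<lambda>D. D) g) v = g (laplacian G (frag_of v))"
    using assms(2) by (simp add: weight_def dual_map_def frag_of_in_Div)
  also have "\<dots> = (\<Sum>u\<in>verts G. ?F u * lap (point v) u)"
    by (simp add: hom_Div_expand[OF assms(1)] lookup_laplacian lookup_frag_of_point mult.commute del: lookup_frag_of)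
  also have "\<dots> = (\<Sum>u\<in>verts G. lap ?F u * point v u)" by (rule lap_self_adjoint)
  also have "\<dots> = lap ?F v" using assms(2) by (rule sum_point')
  finally show ?thesis .
qed

section \<open>The Euler characteristic\<close>

lemma abelian_rank_dual_Div: "abelian_rank (dual_group (Div G)) = card (verts G)"
proof (rule abelian_rank_eqI[where \<phi> = "\<lambda>v f. f (frag_of v)"
      and b = "\<lambda>v. \<lambda>D\<in>carrier (Div G). Poly_Mapping.lookup D v"])
  show "comm_group (dual_group (Div G))" by (rule comm_group_dual_group[OF group_Div])
  show "(\<lambda>f. f (frag_of v)) \<in> hom (dual_group (Div G)) integer_group" if "v \<in> verts G" for v
    by (rule eval_hom_dual_group) (rule frag_of_in_Div[OF that])
  show "f = \<one>\<^bsub>dual_group (Div G)\<^esub>"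
    if f: "f \<in> carrier (dual_group (Div G))" and "\<And>v. v \<in> verts G \<Longrightarrow> f (frag_of v) = 0" for f
  proof (rule dual_group_eqI[OF f one_in_dual_group[OF group_Div]])
    fix x assume x: "x \<in> carrier (Div G)"
    have "f \<in> hom (Div G) integer_group" using f by (simp add: dual_group_def)
    from hom_Div_expand[OF this x] that(2) x show "f x = \<one>\<^bsub>dual_group (Div G)\<^esub> x"
      by (simp add: dual_group_def)
  qed
  show "(\<lambda>D\<in>carrier (Div G). Poly_Mapping.lookup D v) \<in> carrier (dual_group (Div G))" for v
    using group.is_monoid[OF group_Div, THEN monoid.m_closed]
    by (auto simp: dual_group_def hom_def lookup_add)
  fix c :: "'v \<Rightarrow> int" and v
  assume eq: "\<And>u. u \<in> verts G \<Longrightarrow>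
      (\<Sum>v\<in>verts G. c v * (\<lambda>D\<in>carrier (Div G). Poly_Mapping.lookup D v) (frag_of u)) = 0"
    and v: "v \<in> verts G"
  have "c v = (\<Sum>u\<in>verts G. c u * point v u)" using v by (rule sum_point'[symmetric])
  also have "\<dots> = 0" using eq[OF v] v by (simp add: frag_of_in_Div lookup_frag_of_point del: lookup_frag_of)
  finally show "c v = 0" .
qed simp

text \<open>
  A functional on \<open>Prin G\<close> is determined by its weights off one vertex \<open>q\<close>, since the weights sum to
  zero.  Against these coordinates the restricted evaluations at the vertices other than \<open>q\<close> form the
  reduced Laplacian, whose kernel is trivial by the minimum principle.
\<close>

lemma abelian_rank_dual_Prin: "abelian_rank (dual_group (Prin G)) = card (verts G) - 1"
proof -
  obtain q where q: "q \<in> verts G" using V_nonempty by blast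
  have "abelian_rank (dual_group (Prin G)) = card (verts G - {q})"
  proof (rule abelian_rank_eqI[where \<phi> = "\<lambda>v f. weight f v"
        and b = "\<lambda>v. \<lambda>D\<in>carrier (Prin G). Poly_Mapping.lookup D v"])
    show "comm_group (dual_group (Prin G))" by (rule comm_group_dual_group[OF group_Prin])
    show "(\<lambda>f. weight f v) \<in> hom (dual_group (Prin G)) integer_group" if "v \<in> verts G - {q}" for v
      unfolding weight_def by (rule eval_hom_dual_group) (use that frag_of_in_Div in auto)
    show "f = \<one>\<^bsub>dual_group (Prin G)\<^esub>"
      if f: "f \<in> carrier (dual_group (Prin G))" and zero: "\<And>v. v \<in> verts G - {q} \<Longrightarrow> weight f v = 0" for f
    proof (rule weight_determines[OF f one_in_dual_group[OF group_Prin]])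
      fix v assume v: "v \<in> verts G"
      have "weight f q = 0"
        using sum_weight[OF f] zero by (simp add: sum.remove[OF _ q])
      then have "weight f v = 0" using zero[of v] v by (cases "v = q") auto
      then show "weight f v = weight \<one>\<^bsub>dual_group (Prin G)\<^esub> v"
        using v by (simp add: dual_group_def weight_def frag_of_in_Div)
    qed
    show "(\<lambda>D\<in>carrier (Prin G). Poly_Mapping.lookup D v) \<in> carrier (dual_group (Prin G))" for v
      using group.is_monoid[OF group_Prin, THEN monoid.m_closed]
      by (auto simp: dual_group_def hom_def lookup_add)
    fix c :: "'v \<Rightarrow> int" and v
    assume eq: "\<And>u. u \<in> verts G - {q} \<Longrightarrow>
        (\<Sum>v\<in>verts G - {q}. c v * weight (\<lambda>D\<in>carrier (Prin G). Poly_Mapping.lookup D v) u) = 0"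
      and v: "v \<in> verts G - {q}"
    define d where "d v = (if v = q then 0 else c v)" for v
    have lap_d: "lap d u = 0" if u: "u \<in> verts G - {q}" for u
    proof -
      have "lap d u = (\<Sum>v\<in>verts G. lap d v * point u v)" using u by (intro sum_point'[symmetric]) auto
      also have "\<dots> = (\<Sum>v\<in>verts G. d v * lap (point u) v)" by (rule lap_self_adjoint[symmetric])
      also have "\<dots> = (\<Sum>v\<in>verts G - {q}. c v * lap (point u) v)"
        using q by (intro sum.mono_neutral_cong_right) (auto simp: d_def)
      also have "\<dots> = 0"
        using eq[OF u] u by (simp add: weight_def frag_of_in_Div lookup_laplacian lookup_frag_of_point del: lookup_frag_of)
      finally show ?thesis .
    qed
    have "lap d q = 0" using sum_lap[of d] lap_d by (simp add: sum.remove[OF _ q] del: sum_lap)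
    then have "lap d u = 0" if "u \<in> verts G" for u using lap_d[of u] that by (cases "u = q") auto
    then obtain a where a: "\<And>u. u \<in> verts G \<Longrightarrow> d u = a" using harmonic_imp_constant[of d] by blast
    show "c v = 0" using a[OF q] a[of v] v by (simp add: d_def)
  qed simp
  then show ?thesis using q by simp
qed

lemma master_euler_char_eq_1: "master_euler_char G = 1"
proof -
  have "card (verts G) > 0" using V_nonempty by (simp add: card_gt_0_iff)
  then show ?thesis
    by (simp add: master_euler_char_def derived_dual_def D_div_def
        abelian_rank_dual_Div abelian_rank_dual_Prin)
qed

section \<open>Cohomology of the dual divisor complex\<close>

text \<open>
  The degree map is surjective, so its dual is injective.
\<close>

lemma trivial_H_neg: "trivial_group (H_neg (derived_dual (D_div G)))"
proof -
  interpret group_hom "dual_group integer_group" "dual_group (Div G)" "dual_map (Div G) (divisor_deg G)"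
    by (rule group_hom_dual_map[OF group_Div group_integer_group divisor_deg_hom])
  let ?K = "kernel (dual_group integer_group) (dual_group (Div G)) (dual_map (Div G) (divisor_deg G))"
  obtain q where q: "q \<in> verts G" using V_nonempty by blast
  have "f = \<one>\<^bsub>dual_group integer_group\<^esub>" if f: "f \<in> ?K" for f
  proof (rule dual_group_eqI)
    show "f \<in> carrier (dual_group integer_group)" using f by (simp add: kernel_def)
    show "\<one>\<^bsub>dual_group integer_group\<^esub> \<in> carrier (dual_group integer_group)"
      by (rule one_in_dual_group[OF group_integer_group])
    fix k :: int
    let ?D = "divisor_of (\<lambda>v. k * point q v)"
    have "divisor_deg G ?D = k"
    proof -
      have "divisor_deg G ?D = (\<Sum>v\<in>verts G. k * point v q)"
        by (simp add: divisor_deg_def lookup_divisor_of point_commute)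
      then show ?thesis using sum_point[OF q, of "\<lambda>_. k"] by simp
    qed
    moreover have "dual_map (Div G) (divisor_deg G) f ?D = \<one>\<^bsub>dual_group (Div G)\<^esub> ?D"
      using f by (simp add: kernel_def)
    ultimately show "f k = \<one>\<^bsub>dual_group integer_group\<^esub> k"
      by (simp add: dual_map_def dual_group_def)
  qed
  moreover have "\<one>\<^bsub>dual_group integer_group\<^esub> \<in> ?K"
    using subgroup_kernel by (rule subgroup.one_closed)
  ultimately have "?K = {\<one>\<^bsub>dual_group integer_group\<^esub>}" by blast
  moreover have "group (dual_group integer_group\<lparr>carrier := ?K\<rparr>)"
    using subgroup_kernel by (rule G.subgroup_imp_group)
  ultimately show ?thesis
    by (simp add: trivial_group_def H_neg_def derived_dual_def D_div_def)
qed

lemma trivial_FactGroup_carrier: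
  assumes "group B"
  shows "trivial_group (B Mod carrier B)"
proof -
  interpret group B by fact
  have "carrier B \<lhd> B" by (rule normal_self)
  then have "group (B Mod carrier B)" by (rule normal.factorgroup_is_group)
  moreover have "rcosets\<^bsub>B\<^esub> (carrier B) = {carrier B}"
    using coset_join2[OF _ subgroup_self] one_closed by (auto simp: RCOSETS_def)
  ultimately show ?thesis by (simp add: trivial_group_def FactGroup_def)
qed

text \<open>
  A functional on \<open>Div G\<close> that kills \<open>Prin G\<close> is given by a harmonic function, hence by a constant
  one; so it is a multiple of the degree.
\<close>

lemma trivial_H_zero: "trivial_group (H_zero (derived_dual (D_div G)))"
proof -
  let ?Div = "dual_group (Div G)" and ?Prin = "dual_group (Prin G)"
  interpret group_hom ?Div ?Prin "dual_map (Prin G) (\<lambda>D. D)"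
    by (rule group_hom_dual_map[OF group_Prin group_Div inclusion_hom])
  let ?K = "kernel ?Div ?Prin (dual_map (Prin G) (\<lambda>D. D))"
  let ?I = "dual_map (Div G) (divisor_deg G) ` carrier (dual_group integer_group)"
  interpret deg: group_hom "dual_group integer_group" ?Div "dual_map (Div G) (divisor_deg G)"
    by (rule group_hom_dual_map[OF group_Div group_integer_group divisor_deg_hom])
  have "?I = ?K"
  proof (intro equalityI subsetI)
    fix g assume "g \<in> ?I"
    then obtain f where f: "f \<in> carrier (dual_group integer_group)"
      and g: "g = dual_map (Div G) (divisor_deg G) f" by blast
    have gD: "g \<in> carrier ?Div" unfolding g using f by (rule deg.hom_closed)
    have "\<forall>x y. f (x + y) = f x + f y" using f by (simp add: dual_group_def hom_def)
    from spec[OF spec[OF this, of 0], of 0] have "f 0 = 0" by simp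
    have "g y = 0" if "y \<in> carrier (Prin G)" for y
      using that \<open>f 0 = 0\<close>
      by (auto simp: Prin_def g dual_map_def divisor_deg_def lookup_laplacian)
    then have "dual_map (Prin G) (\<lambda>D. D) g = \<one>\<^bsub>?Prin\<^esub>"
      by (auto simp: dual_map_def dual_group_def)
    then show "g \<in> ?K" using gD by (simp add: kernel_def)
  next
    fix g assume "g \<in> ?K"
    then have gD: "g \<in> carrier ?Div" and one: "dual_map (Prin G) (\<lambda>D. D) g = \<one>\<^bsub>?Prin\<^esub>"
      by (auto simp: kernel_def)
    have gh: "g \<in> hom (Div G) integer_group" using gD by (simp add: dual_group_def)
    have "lap (\<lambda>u. g (frag_of u)) v = 0" if "v \<in> verts G" for v
      using weight_restriction[OF gh that] that one
      by (simp add: weight_def dual_group_def frag_of_in_Div)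
    then obtain c where c: "\<And>v. v \<in> verts G \<Longrightarrow> g (frag_of v) = c"
      using harmonic_imp_constant[of "\<lambda>u. g (frag_of u)"] by blast
    have f: "(\<lambda>k. c * k) \<in> carrier (dual_group integer_group)"
      by (auto simp: dual_group_def hom_def algebra_simps)
    have "g = dual_map (Div G) (divisor_deg G) (\<lambda>k. c * k)"
    proof (rule dual_group_eqI[OF gD deg.hom_closed[OF f]])
      fix x assume x: "x \<in> carrier (Div G)"
      show "g x = dual_map (Div G) (divisor_deg G) (\<lambda>k. c * k) x"
        using x by (simp add: hom_Div_expand[OF gh x] c dual_map_def divisor_deg_def
            sum_distrib_left mult.commute)
    qed
    then show "g \<in> ?I" using f by blast
  qed
  moreover have "trivial_group (?Div\<lparr>carrier := ?K\<rparr> Mod ?K)"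
    using trivial_FactGroup_carrier[OF G.subgroup_imp_group[OF subgroup_kernel]] by simp
  ultimately show ?thesis by (simp add: H_zero_def derived_dual_def D_div_def)
qed

text \<open>
  The torsion of the Jacobian is its degree-zero part.
\<close>

lemma torsion_iff_degree_zero:
  assumes "D \<in> carrier (Div G)"
  shows "(\<exists>n::nat. 0 < n \<and> frag_cmul (int n) D \<in> carrier (Prin G)) \<longleftrightarrow> divisor_deg G D = 0"
proof -
  have nD: "frag_cmul (int n) D \<in> carrier (Div G)" for n
    using assms keys_cmul[of "int n" D] by (auto simp: carrier_Div)
  show ?thesis
  proof
    assume "\<exists>n::nat. 0 < n \<and> frag_cmul (int n) D \<in> carrier (Prin G)"
    then obtain n :: nat and f where n: "0 < n"
      and f: "\<And>v. v \<in> verts G \<Longrightarrow> int n * Poly_Mapping.lookup D v = lap f v"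
      using in_Prin_iff[OF nD] by auto
    have "int n * divisor_deg G D = (\<Sum>v\<in>verts G. lap f v)"
      unfolding divisor_deg_def sum_distrib_left using f by (rule sum.cong[OF refl])
    then show "divisor_deg G D = 0" using n by simp
  next
    assume "divisor_deg G D = 0"
    then obtain n :: nat and f where "0 < n"
      "\<And>v. v \<in> verts G \<Longrightarrow> int n * Poly_Mapping.lookup D v = lap f v"
      using degree_zero_imp_torsion[of "Poly_Mapping.lookup D"] by (auto simp: divisor_deg_def)
    then show "\<exists>n::nat. 0 < n \<and> frag_cmul (int n) D \<in> carrier (Prin G)"
      using in_Prin_iff[OF nD] by auto
  qed
qed

text \<open>
  The map \<open>\<theta>\<close> sends a functional on \<open>Prin G\<close> to the class of its weight divisor.  Its image consists
  of the classes of degree zero, which form the torsion subgroup; its kernel consists of the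
  functionals whose weight divisor is principal, and these are the restrictions from \<open>Div G\<close>.
\<close>

lemma H_pos_iso_torsion: "H_pos (derived_dual (D_div G)) \<cong> tors (Jac G)"
proof -
  let ?Div = "dual_group (Div G)" and ?Prin = "dual_group (Prin G)"
  let ?res = "dual_map (Prin G) (\<lambda>D. D)"
  let ?cls = "\<lambda>D. carrier (Prin G) #>\<^bsub>Div G\<^esub> D"
  define \<theta> where "\<theta> f = ?cls (divisor_of (weight f))" for f
  interpret D: comm_group "Div G" by (rule comm_group_Div)
  interpret N: normal "carrier (Prin G)" "Div G"
    by (rule D.subgroup_imp_normal[OF subgroup_Prin])
  have Jac_group: "group (Jac G)" unfolding Jac_def by (rule N.factorgroup_is_group)
  interpret Prin: comm_group ?Prin by (rule comm_group_dual_group[OF group_Prin])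
  interpret res: group_hom ?Div ?Prin ?res
    by (rule group_hom_dual_map[OF group_Prin group_Div inclusion_hom])
  interpret cls: group_hom "Div G" "Jac G" ?cls
    using N.r_coset_hom_Mod group_Div Jac_group
    by (simp add: group_hom_def group_hom_axioms_def Jac_def)
  have cls_one: "?cls D = \<one>\<^bsub>Jac G\<^esub> \<longleftrightarrow> D \<in> carrier (Prin G)" if "D \<in> carrier (Div G)" for D
    using D.coset_join2[OF that subgroup_Prin] D.rcos_self[OF that subgroup_Prin]
    by (auto simp: Jac_def FactGroup_def)
  have weight_mult: "weight (f \<otimes>\<^bsub>?Prin\<^esub> g) v = weight f v + weight g v" if "v \<in> verts G" for f g v
    using that by (simp add: weight_def dual_group_def frag_of_in_Div)
  have "\<theta> \<in> hom ?Prin (Jac G)"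
  proof (rule homI)
    fix f g
    have "divisor_of (weight (f \<otimes>\<^bsub>?Prin\<^esub> g)) = divisor_of (weight f) + divisor_of (weight g)"
      by (rule poly_mapping_eqI) (auto simp: lookup_divisor_of lookup_add weight_mult)
    then show "\<theta> (f \<otimes>\<^bsub>?Prin\<^esub> g) = \<theta> f \<otimes>\<^bsub>Jac G\<^esub> \<theta> g"
      unfolding \<theta>_def using cls.hom_mult[of "divisor_of (weight f)" "divisor_of (weight g)"] by simp
  qed (auto simp: \<theta>_def intro!: cls.hom_closed)
  then interpret \<theta>: group_hom ?Prin "Jac G" \<theta>
    using Jac_group Prin.is_group by (simp add: group_hom_def group_hom_axioms_def)
  have tors: "tors (Jac G) = (Jac G)\<lparr>carrier := \<theta> ` carrier ?Prin\<rparr>"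
  proof -
    have "{X \<in> carrier (Jac G). \<exists>n::nat. n > 0 \<and> X [^]\<^bsub>Jac G\<^esub> n = \<one>\<^bsub>Jac G\<^esub>}
        = ?cls ` {D \<in> carrier (Div G). divisor_deg G D = 0}"
    proof -
      have "(\<exists>n::nat. n > 0 \<and> ?cls D [^]\<^bsub>Jac G\<^esub> n = \<one>\<^bsub>Jac G\<^esub>) \<longleftrightarrow> divisor_deg G D = 0"
        if "D \<in> carrier (Div G)" for D
      proof -
        have "?cls D [^]\<^bsub>Jac G\<^esub> n = \<one>\<^bsub>Jac G\<^esub> \<longleftrightarrow> frag_cmul (int n) D \<in> carrier (Prin G)" for n :: nat
          using cls.hom_nat_pow[OF that, of n] cls_one[of "D [^]\<^bsub>Div G\<^esub> n"] that
          by (simp add: D.nat_pow_closed) (simp add: Div_def)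
        then show ?thesis using torsion_iff_degree_zero[OF that] by simp
      qed
      moreover have "carrier (Jac G) = ?cls ` carrier (Div G)"
        by (auto simp: Jac_def FactGroup_def RCOSETS_def)
      ultimately show ?thesis by auto
    qed
    also have "\<dots> = \<theta> ` carrier ?Prin"
    proof (intro equalityI subsetI)
      fix X assume "X \<in> ?cls ` {D \<in> carrier (Div G). divisor_deg G D = 0}"
      then obtain D where D: "D \<in> carrier (Div G)" "divisor_deg G D = 0" "X = ?cls D" by blast
      obtain f where f: "f \<in> carrier ?Prin" "\<And>v. v \<in> verts G \<Longrightarrow> weight f v = Poly_Mapping.lookup D v"
        using ex_weight[of "Poly_Mapping.lookup D"] D(2) by (auto simp: divisor_deg_def)
      have "divisor_of (weight f) = D"
        using f D(1) by (intro Div_eqI) (auto simp: lookup_divisor_of)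
      then show "X \<in> \<theta> ` carrier ?Prin" using f(1) D(3) by (auto simp: \<theta>_def)
    next
      fix X assume "X \<in> \<theta> ` carrier ?Prin"
      then obtain f where f: "f \<in> carrier ?Prin" "X = \<theta> f" by blast
      have "divisor_deg G (divisor_of (weight f)) = 0"
        using sum_weight[OF f(1)] by (simp add: divisor_deg_def lookup_divisor_of)
      then show "X \<in> ?cls ` {D \<in> carrier (Div G). divisor_deg G D = 0}"
        using f(2) by (auto simp: \<theta>_def)
    qed
    finally show ?thesis by (simp add: tors_def)
  qed
  have kernel: "kernel ?Prin (Jac G) \<theta> = ?res ` carrier ?Div"
  proof (intro equalityI subsetI)
    fix f assume "f \<in> kernel ?Prin (Jac G) \<theta>"
    then have f: "f \<in> carrier ?Prin" and "divisor_of (weight f) \<in> carrier (Prin G)"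
      by (auto simp: kernel_def \<theta>_def cls_one)
    then obtain F where F: "\<And>v. v \<in> verts G \<Longrightarrow> weight f v = lap F v"
      using in_Prin_iff[of "divisor_of (weight f)"] by (auto simp: lookup_divisor_of)
    define g where "g = (\<lambda>D\<in>carrier (Div G). \<Sum>v\<in>verts G. F v * Poly_Mapping.lookup D v)"
    have g: "g \<in> carrier ?Div"
      using linear_in_hom_Div[of F] D.m_closed by (auto simp: g_def dual_group_def hom_def)
    then have gh: "g \<in> hom (Div G) integer_group" by (simp add: dual_group_def)
    have g_frag: "g (frag_of v) = F v" if "v \<in> verts G" for v
    proof -
      have "g (frag_of v) = (\<Sum>u\<in>verts G. F u * point v u)"
        using that by (simp add: g_def frag_of_in_Div lookup_frag_of_point del: lookup_frag_of)
      then show ?thesis using that by (simp add: sum_point')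
    qed
    have "f = ?res g"
    proof (rule weight_determines[OF f res.hom_closed[OF g]])
      fix v assume v: "v \<in> verts G"
      show "weight f v = weight (?res g) v"
        unfolding weight_restriction[OF gh v] F[OF v] by (rule lap_cong[OF _ v]) (simp add: g_frag)
    qed
    then show "f \<in> ?res ` carrier ?Div" using g by blast
  next
    fix f assume "f \<in> ?res ` carrier ?Div"
    then obtain g where g: "g \<in> carrier ?Div" and f: "f = ?res g" by blast
    have gh: "g \<in> hom (Div G) integer_group" using g by (simp add: dual_group_def)
    have "divisor_of (weight f) \<in> carrier (Prin G)"
      using weight_restriction[OF gh] by (auto simp: in_Prin_iff lookup_divisor_of f)
    then show "f \<in> kernel ?Prin (Jac G) \<theta>"
      using res.hom_closed[OF g] by (auto simp: kernel_def \<theta>_def cls_one f)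
  qed
  interpret tors: group_hom ?Prin "tors (Jac G)" \<theta>
  proof -
    have "group (tors (Jac G))"
      unfolding tors using \<theta>.img_is_subgroup by (rule group.subgroup_imp_group[OF Jac_group])
    moreover have "\<theta> \<in> hom ?Prin (tors (Jac G))"
      using \<theta>.homh by (auto simp: tors hom_def)
    ultimately show "group_hom ?Prin (tors (Jac G)) \<theta>"
      using Prin.is_group by (simp add: group_hom_def group_hom_axioms_def)
  qed
  have "?Prin Mod kernel ?Prin (tors (Jac G)) \<theta> \<cong> tors (Jac G)"
    by (rule tors.FactGroup_iso) (simp add: tors)
  moreover have "kernel ?Prin (tors (Jac G)) \<theta> = kernel ?Prin (Jac G) \<theta>"
    by (simp add: kernel_def tors_def)
  ultimately show ?thesis by (simp add: kernel H_pos_def derived_dual_def D_div_def)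
qed

end

theorem theorem6p38:
  fixes G :: "('v,'e) pre_digraph" and D :: "'v \<Rightarrow>\<^sub>0 int"
  assumes "fin_digraph G"
    and "loopfree_digraph G"
    and "Digraph_Component.connected G"
    and "D \<in> carrier (Div G)"
  shows "divisor_rank G D - divisor_rank G (canonical_divisor G - D)
           = divisor_deg G D + 1 - genus G
    \<and> divisor_rank G D - divisor_rank G (canonical_divisor G - D)
           = divisor_deg G D + master_euler_char G - genus G
    \<and> master_euler_char G = 1
    \<and> trivial_group (H_neg (derived_dual (D_div G)))
    \<and> trivial_group (H_zero (derived_dual (D_div G)))
    \<and> H_pos (derived_dual (D_div G)) \<cong> tors (Jac G)"
proof -
  interpret connected_multigraph G
    using assms(1-3) by (simp add: connected_multigraph_def connected_multigraph_axioms_def)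
  show ?thesis
    using Riemann_Roch[of D] master_euler_char_eq_1 trivial_H_neg trivial_H_zero H_pos_iso_torsion
    by simp
qed


end
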